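(* Let $r \geq 1$ be a constant. If there exists a polynomial-time $r$-approximation algorithm for the Min-WCS problem, then there exists a polynomial-time $r$-approximation algorithm for the Min-Age problem.
   Context: Min-Age problem. Input: a positive integer $n$, an integer $T_0 \geq 0$, and for each $i \in \{1,\dots,n\}$ a positive integer $m_i$ and messages $M_i^0, M_i^1, \dots, M_i^{m_i}$ with integer birthdays $b(M_i^j)$ satisfying $0 \leq b(M_i^0) < b(M_i^1) < \cdots < b(M_i^{m_i}) \leq T_0$. Let $\mathcal{M}_i = \{M_i^1,\dots,M_i^{m_i}\}$ (so $m_i=|\mathcal{M}_i|$; $M_i^0$ is the latest message already received by receiver $i$ by time $T_0$) and $T = \sum_i m_i$. A feasible schedule $S$ is a bijection from $\mathcal{M}_1\cup\cdots\cup\mathcal{M}_n$ to $\{T_0+1,\dots,T_0+T\}$ with $S(M_i^1) < \cdots < S(M_i^{m_i})$ for every $i$. For $t$ an integer, $lm(S,i,t)$ is $M_i^j$ where $j$ is the largest index in $\{0,\dots,m_i\}$ with $j=0$ or $S(M_i^j)\leq t$; $age(S,i,t) = t - b(lm(S,i,t))$ if $lm(S,i,t) \neq M_i^{m_i}$ and $age(S,i,t)=0$ otherwise. $Age(S) = \sum_{i=1}^n \sum_{t=T_0}^{T_0+T} age(S,i,t)$; the goal is a feasible schedule minimizing $Age(S)$. Min-WCS problem. Input: a positive integer $n$ and job chains $\mathcal{C}_1,\dots,\mathcal{C}_n$, where $\mathcal{C}_i$ consists of $|\mathcal{C}_i|\geq 1$ jobs $J_i^1 \to J_i^2 \to \cdots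 \to J_i^{|\mathcal{C}_i|}$, each job $J_i^j$ having a non-negative weight $w_i^j$. The job $J_i^{|\mathcal{C}_i|}$ is the leaf job of $\mathcal{C}_i$. Every job has unit processing time and there is one machine. With $T=\sum_i |\mathcal{C}_i|$, a feasible schedule $S$ is a bijection from the set of all jobs to $\{1,\dots,T\}$ ($S(J)$ is the completion time of $J$) with $S(J_i^1)<\cdots<S(J_i^{|\mathcal{C}_i|})$ for all $i$. Let $wc(S)=\sum_{i,j} w_i^j S(J_i^j)$, $cs(S)=\sum_{i} S(J_i^{|\mathcal{C}_i|})^2$, and $wcs(S)=wc(S)+cs(S)$; the goal is a feasible schedule minimizing $wcs(S)$. An $r$-approximation algorithm for a minimization problem is an algorithm that always outputs a feasible solution of objective value at most $r$ times the optimum. *)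

theory Defs
  imports Complex_Main "HOL-Computational_Algebra.Polynomial"
begin

section \<open>Deterministic multi-tape Turing machines\<close>

text \<open>
  Symbols are natural numbers and 0 is the blank. A tape is a pair \<open>ls, rs\<close>: \<open>rs\<close> is the
  scanned cell followed by the cells to its right, and \<open>ls\<close> lists the cells to its left, nearest
  first. Cells beyond the end of either list are blank, so tapes are infinite in both directions.
\<close>

type_synonym tape = "nat list \<times> nat list"

datatype move = MoveLeft | Stay | MoveRight

fun tape_read :: "tape \<Rightarrow> nat" where
  "tape_read (ls, []) = 0"
| "tape_read (ls, a # rs) = a"

fun tape_write :: "nat \<Rightarrow> tape \<Rightarrow> tape" where
  "tape_write a (ls, rs) = (ls, a # tl rs)"

fun tape_move :: "move \<Rightarrow> tape \<Rightarrow> tape" where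
  "tape_move Stay t = t"
| "tape_move MoveLeft ([], rs) = ([], 0 # rs)"
| "tape_move MoveLeft (a # ls, rs) = (ls, a # rs)"
| "tape_move MoveRight (ls, []) = (0 # ls, [])"
| "tape_move MoveRight (ls, a # rs) = (a # ls, rs)"

definition tape_act :: "nat \<times> move \<Rightarrow> tape \<Rightarrow> tape" where
  "tape_act am t = tape_move (snd am) (tape_write (fst am) t)"

text \<open>
  The states are \<open>0, \<dots>, num_states\<close>, where 0 is the start state and \<open>num_states\<close> is the only
  halting state. The tape alphabet is \<open>0, \<dots>, num_symbols - 1\<close>.
\<close>

record turing_machine =
  num_tapes :: nat
  num_states :: nat
  num_symbols :: nat
  transition :: "nat \<Rightarrow> nat list \<Rightarrow> nat \<times> (nat \<times> move) list"

text \<open>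
  The bound 5 makes the alphabet contain the blank and the four symbols used by the encodings below.
\<close>

definition wf_tm :: "turing_machine \<Rightarrow> bool" where
  "wf_tm M \<longleftrightarrow>
     1 \<le> num_tapes M \<and> 5 \<le> num_symbols M \<and>
     (\<forall>q as. q < num_states M \<and> length as = num_tapes M \<and> set as \<subseteq> {..<num_symbols M} \<longrightarrow>
        (case transition M q as of (q', acts) \<Rightarrow>
           q' \<le> num_states M \<and> length acts = num_tapes M \<and>
           (\<forall>(a, d) \<in> set acts. a < num_symbols M)))"

fun tm_step :: "turing_machine \<Rightarrow> nat \<times> tape list \<Rightarrow> nat \<times> tape list" where
  "tm_step M (q, ts) =
     (if q < num_states M
      then (case transition M q (map tape_read ts) of (q', acts) \<Rightarrow> (q', map2 tape_act acts ts))
      else (q, ts))"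

definition tm_init :: "turing_machine \<Rightarrow> nat list \<Rightarrow> nat \<times> tape list" where
  "tm_init M x = (0, ([], x) # replicate (num_tapes M - 1) ([], []))"

text \<open>
  Input and output are on the first tape; the output is the maximal blank-free word that starts at
  the head position. A halted configuration does not change any more, so being halted after exactly
  \<open>t\<close> steps means having halted within \<open>t\<close> steps.
\<close>

definition tm_computes_within :: "turing_machine \<Rightarrow> nat list \<Rightarrow> nat list \<Rightarrow> nat \<Rightarrow> bool" where
  "tm_computes_within M x y t \<longleftrightarrow>
     (case (tm_step M ^^ t) (tm_init M x) of (q, ts) \<Rightarrow>
        q = num_states M \<and> takeWhile (\<lambda>a. a \<noteq> 0) (snd (ts ! 0)) = y)"


section \<open>Minimization problems and approximation algorithms\<close>

record ('i, 's) min_problem =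
  instances :: "'i set"
  feasible :: "'i \<Rightarrow> 's set"
  objective :: "'i \<Rightarrow> 's \<Rightarrow> real"
  encode_instance :: "'i \<Rightarrow> nat list"
  encode_solution :: "'i \<Rightarrow> 's \<Rightarrow> nat list"

definition optimum :: "('i, 's) min_problem \<Rightarrow> 'i \<Rightarrow> real" where
  "optimum P I = (INF S \<in> feasible P I. objective P I S)"

definition poly_time_approx_algorithm ::
    "real \<Rightarrow> ('i, 's) min_problem \<Rightarrow> turing_machine \<Rightarrow> bool" where
  "poly_time_approx_algorithm r P M \<longleftrightarrow>
     wf_tm M \<and>
     (\<exists>p :: nat poly. \<forall>I \<in> instances P. \<exists>S \<in> feasible P I.
        tm_computes_within M (encode_instance P I) (encode_solution P I S)
          (poly p (length (encode_instance P I))) \<and>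
        objective P I S \<le> r * optimum P I)"


section \<open>Encodings\<close>

text \<open>
  Numbers are written in binary, least significant bit first and without superfluous zeros. The
  symbols 1 and 2 are the bits 0 and 1, the symbol 3 ends a number and the symbol 4 ends a list.
\<close>

fun bits :: "nat \<Rightarrow> nat list" where
  "bits k = (if k = 0 then [] else (1 + k mod 2) # bits (k div 2))"

declare bits.simps [simp del]

definition enc_nat :: "nat \<Rightarrow> nat list" where
  "enc_nat k = bits k @ [3]"

definition enc_list :: "('a \<Rightarrow> nat list) \<Rightarrow> 'a list \<Rightarrow> nat list" where
  "enc_list enc xs = concat (map enc xs) @ [4]"

text \<open>A non-negative rational is given by numerator and denominator in lowest terms.\<close>

definition enc_rat :: "rat \<Rightarrow> nat list" where
  "enc_rat w = (case quotient_of w of (a, b) \<Rightarrow> enc_nat (nat a) @ enc_nat (nat b))"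


section \<open>Schedules of chains\<close>

text \<open>
  There are \<open>n\<close> chains; the elements of chain \<open>i \<in> {1..n}\<close> are the pairs \<open>(i, j)\<close> with
  \<open>j \<in> {1..len i}\<close>, and a schedule \<open>S\<close> assigns to this element the time \<open>S i j\<close>. Values of
  \<open>S\<close> outside these ranges are irrelevant.
\<close>

definition chain_schedules :: "nat \<Rightarrow> (nat \<Rightarrow> nat) \<Rightarrow> nat \<Rightarrow> (nat \<Rightarrow> nat \<Rightarrow> nat) set" where
  "chain_schedules n len t0 =
     {S. bij_betw (\<lambda>(i, j). S i j) (SIGMA i:{1..n}. {1..len i})
           {t0 + 1..t0 + (\<Sum>i = 1..n. len i)} \<and>
         (\<forall>i \<in> {1..n}. strict_mono_on {1..len i} (S i))}"

definition enc_schedule :: "nat \<Rightarrow> (nat \<Rightarrow> nat) \<Rightarrow> (nat \<Rightarrow> nat \<Rightarrow> nat) \<Rightarrow> nat list" where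
  "enc_schedule n len S =
     enc_list (enc_list enc_nat) (map (\<lambda>i. map (S i) [1..<len i + 1]) [1..<n + 1])"


section \<open>The Min-Age problem\<close>

text \<open>
  The message \<open>M\<^sub>i\<^sup>j\<close> is represented by its indices, for \<open>i \<in> {1..receivers I}\<close> and
  \<open>j \<in> {0..messages I i}\<close>, and its birthday is \<open>birthday I i j\<close>.
\<close>

record age_instance =
  receivers :: nat
  start_time :: nat
  messages :: "nat \<Rightarrow> nat"
  birthday :: "nat \<Rightarrow> nat \<Rightarrow> nat"

definition age_instances :: "age_instance set" where
  "age_instances =
     {I. 1 \<le> receivers I \<and>
         (\<forall>i \<in> {1..receivers I}.
            1 \<le> messages I i \<and>
            strict_mono_on {0..messages I i} (birthday I i) \<and>
            birthday I i (messages I i) \<le> start_time I)}"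

definition total_messages :: "age_instance \<Rightarrow> nat" where
  "total_messages I = (\<Sum>i = 1..receivers I. messages I i)"

definition lm :: "age_instance \<Rightarrow> (nat \<Rightarrow> nat \<Rightarrow> nat) \<Rightarrow> nat \<Rightarrow> nat \<Rightarrow> nat" where
  "lm I S i t = Max {j \<in> {0..messages I i}. j = 0 \<or> S i j \<le> t}"

definition age :: "age_instance \<Rightarrow> (nat \<Rightarrow> nat \<Rightarrow> nat) \<Rightarrow> nat \<Rightarrow> nat \<Rightarrow> int" where
  "age I S i t =
     (if lm I S i t \<noteq> messages I i then int t - int (birthday I i (lm I S i t)) else 0)"

definition total_age :: "age_instance \<Rightarrow> (nat \<Rightarrow> nat \<Rightarrow> nat) \<Rightarrow> int" where
  "total_age I S =
     (\<Sum>i = 1..receivers I. \<Sum>t = start_time I..start_time I + total_messages I. age I S i t)"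

definition enc_age :: "age_instance \<Rightarrow> nat list" where
  "enc_age I =
     enc_nat (start_time I) @
     enc_list (enc_list enc_nat)
       (map (\<lambda>i. map (birthday I i) [0..<messages I i + 1]) [1..<receivers I + 1])"

definition min_age :: "(age_instance, nat \<Rightarrow> nat \<Rightarrow> nat) min_problem" where
  "min_age =
     \<lparr>instances = age_instances,
      feasible = (\<lambda>I. chain_schedules (receivers I) (messages I) (start_time I)),
      objective = (\<lambda>I S. real_of_int (total_age I S)),
      encode_instance = enc_age,
      encode_solution = (\<lambda>I. enc_schedule (receivers I) (messages I))\<rparr>"


section \<open>The Min-WCS problem\<close>

text \<open>Weights are rational, so that every instance is a finite input for an algorithm.\<close>

record wcs_instance =
  chains :: nat
  chain_length :: "nat \<Rightarrow> nat"
  weight :: "nat \<Rightarrow> nat \<Rightarrow> rat"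

definition wcs_instances :: "wcs_instance set" where
  "wcs_instances =
     {I. 1 \<le> chains I \<and>
         (\<forall>i \<in> {1..chains I}.
            1 \<le> chain_length I i \<and> (\<forall>j \<in> {1..chain_length I i}. 0 \<le> weight I i j))}"

definition wc :: "wcs_instance \<Rightarrow> (nat \<Rightarrow> nat \<Rightarrow> nat) \<Rightarrow> rat" where
  "wc I S = (\<Sum>i = 1..chains I. \<Sum>j = 1..chain_length I i. weight I i j * of_nat (S i j))"

definition cs :: "wcs_instance \<Rightarrow> (nat \<Rightarrow> nat \<Rightarrow> nat) \<Rightarrow> nat" where
  "cs I S = (\<Sum>i = 1..chains I. (S i (chain_length I i))\<^sup>2)"

definition wcs :: "wcs_instance \<Rightarrow> (nat \<Rightarrow> nat \<Rightarrow> nat) \<Rightarrow> rat" where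
  "wcs I S = wc I S + of_nat (cs I S)"

definition enc_wcs :: "wcs_instance \<Rightarrow> nat list" where
  "enc_wcs I =
     enc_list (enc_list enc_rat)
       (map (\<lambda>i. map (weight I i) [1..<chain_length I i + 1]) [1..<chains I + 1])"

definition min_wcs :: "(wcs_instance, nat \<Rightarrow> nat \<Rightarrow> nat) min_problem" where
  "min_wcs =
     \<lparr>instances = wcs_instances,
      feasible = (\<lambda>I. chain_schedules (chains I) (chain_length I) 0),
      objective = (\<lambda>I S. real_of_rat (wcs I S)),
      encode_instance = enc_wcs,
      encode_solution = (\<lambda>I. enc_schedule (chains I) (chain_length I))\<rparr>"

end

theory Submission
  imports Defs
begin

text \<open>
  Write \<open>c\<^sub>j\<close> for the completion times of the messages of one receiver, counted from the start
  time \<open>T\<close>, let \<open>m\<close> be the index of its last message and \<open>b\<^sub>j\<close> the birthdays. Its age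
  is \<open>t - b\<^sub>j\<close> between the deliveries of messages \<open>j\<close> and \<open>j + 1\<close>, so summation by parts
  turns twice its total age into
  \<open>c\<^sub>m\<^sup>2 + (2 (T - b\<^bsub>m-1\<^esub>) - 1) c\<^sub>m\<close> plus the sum of the
  \<open>2 (b\<^sub>j - b\<^bsub>j-1\<^esub>) c\<^sub>j\<close> over \<open>j < m\<close>. All these coefficients are positive integers,
  so twice the age is exactly the \<open>wcs\<close> value for these weights, and approximation ratios carry
  over.

  A machine for Min-Age therefore computes the weights with binary subtractions, runs the given
  machine for Min-WCS on separate tapes, and adds \<open>T\<close> to every number of the schedule it finds.
\<close>

section \<open>Abstract tapes\<close>

text \<open>The given machine for Min-WCS is arbitrary: its number of tapes, its alphabet and
  everything it leaves behind except the output word are unknown. Hence it runs inside a machine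
  with the same alphabet and four more tapes, and its output is read only up to the first blank.

  This is the origin of the side condition \<open>hd0 out \<noteq> 1\<close> on the cell in front of
  a number, which recurs throughout.

  The factor 2 clears the halves that arise from summing consecutive times. The square then has
  coefficient 1, as in \<open>cs\<close>, and a linear remainder \<open>- c\<close> is left over,
  which makes the last weight of each chain odd. The machine obtains it by a different low bit and
  an initial borrow.

  The start time and the birthdays may be exponential in the input length, which forces binary
  arithmetic. The completion times of a Min-WCS schedule are at most the number of messages, hence
  polynomial in the input length.\<close>

text \<open>
  Two concrete tapes that differ only in trailing blanks behave alike. They are identified by
  reading the two halves of a tape as functions.
\<close>

type_synonym atape = "(nat \<Rightarrow> nat) \<times> (nat \<Rightarrow> nat)"

definition tp :: "nat list \<Rightarrow> nat list \<Rightarrow> atape" where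
  "tp l r = (nth_default 0 l, nth_default 0 r)"

definition aread :: "atape \<Rightarrow> nat" where
  "aread t = snd t 0"

text \<open>On infinite halves, \<open>case_nat\<close> is cons and composition with
  \<open>Suc\<close> is tail, so no move has a special case at the end of a list.\<close>

fun aact :: "nat \<times> move \<Rightarrow> atape \<Rightarrow> atape" where
  "aact (a, Stay) (f, g) = (f, g(0 := a))"
| "aact (a, MoveLeft) (f, g) = (\<lambda>n. f (Suc n), case_nat (f 0) (g(0 := a)))"
| "aact (a, MoveRight) (f, g) = (case_nat a f, \<lambda>n. g (Suc n))"

lemma tp_blank:
  fixes P :: "atape \<Rightarrow> bool"
  shows "tp l [0] = tp l []" "tp [0] r = tp [] r" "tp l [x, 0] = tp l [x]"
  by (auto simp: tp_def nth_default_Cons fun_eq_iff split: nat.splits)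

lemma tp_zeros: "tp (replicate n 0) r = tp [] r"
  by (auto simp: tp_def nth_default_def fun_eq_iff)

lemma aread_tp [simp]: "aread (tp l []) = 0" "aread (tp l (a # r)) = a"
  by (simp_all add: aread_def tp_def)

lemma aact_tp [simp]:
  "aact (b, Stay) (tp l []) = tp l [b]"
  "aact (b, Stay) (tp l (a # r)) = tp l (b # r)"
  "aact (b, MoveRight) (tp l []) = tp (b # l) []"
  "aact (b, MoveRight) (tp l (a # r)) = tp (b # l) r"
  "aact (b, MoveLeft) (tp [] []) = tp [] [0, b]"
  "aact (b, MoveLeft) (tp [] (a # r)) = tp [] (0 # b # r)"
  "aact (b, MoveLeft) (tp (x # l) []) = tp l [x, b]"
  "aact (b, MoveLeft) (tp (x # l) (a # r)) = tp l (x # b # r)"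
  by (auto simp: tp_def nth_default_Cons fun_eq_iff split: nat.splits)

lemma aact_idle [simp]: "aact (aread t, Stay) t = t"
  by (cases t) (auto simp: aread_def)

text \<open>Both actions write back the symbol they scan, so only the head position changes.
  \<open>goleft\<close> and \<open>strip\<close> use this to step back after running one cell past
  their target.\<close>

lemma aact_right_left [simp]:
  "aact (aread (aact (aread t, MoveLeft) t), MoveRight) (aact (aread t, MoveLeft) t) = t"
  by (cases t) (auto simp: aread_def fun_eq_iff split: nat.splits)

definition abs_tape :: "tape \<Rightarrow> atape" where
  "abs_tape t = tp (fst t) (snd t)"

lemma aread_abs: "aread (abs_tape t) = tape_read t"
  by (cases t rule: tape_read.cases) (auto simp: abs_tape_def)

lemma aact_abs: "aact am (abs_tape t) = abs_tape (tape_act am t)"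
proof -
  obtain a m where am: "am = (a, m)" by (cases am)
  obtain l r where t: "t = (l, r)" by (cases t)
  show ?thesis
    unfolding am t
    by (cases m; cases l; cases r) (auto simp: abs_tape_def tape_act_def tp_blank)
qed

text \<open>The two lists differ at most by trailing blanks, and \<open>takeWhile\<close> stops
  before those. So the output word of a machine can be read off its abstract tape.\<close>

lemma takeWhile_nonblank:
  assumes "nth_default 0 r = nth_default (0::nat) r'"
  shows "takeWhile (\<lambda>a. a \<noteq> 0) r = takeWhile (\<lambda>a. a \<noteq> 0) r'"
  using assms
proof (induction r arbitrary: r')
  case Nil
  have "nth_default 0 r' 0 = 0" using Nil by (metis nth_default_Nil)
  then show ?case by (cases r') auto
next
  case (Cons a r)
  have 0: "nth_default 0 r' 0 = a" using Cons.prems by (metis nth_default_Cons_0)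
  show ?case
  proof (cases r')
    case Nil
    then show ?thesis using 0 by auto
  next
    case [simp]: (Cons b r'')
    have "nth_default 0 r = nth_default 0 r''"
    proof
      fix n show "nth_default 0 r n = nth_default 0 r'' n"
        using Cons.prems by (metis local.Cons nth_default_Cons_Suc)
    qed
    with Cons.IH 0 show ?thesis by auto
  qed
qed

section \<open>Runs on abstract configurations\<close>

type_synonym aconf = "nat \<Rightarrow> atape"

fun astep :: "turing_machine \<Rightarrow> nat \<times> aconf \<Rightarrow> nat \<times> aconf" where
  "astep M (q, c) =
     (if q < num_states M
      then (case transition M q (map (\<lambda>i. aread (c i)) [0..<num_tapes M]) of (q', acts) \<Rightarrow>
        (q', \<lambda>i. if i < num_tapes M then aact (acts ! i) (c i) else c i))
      else (q, c))"

text \<open>The blank always belongs to the set, because a head beyond the end of a list reads it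
  and a move may store it.\<close>

definition tape_symbols :: "tape \<Rightarrow> nat set" where
  "tape_symbols t = insert 0 (set (fst t) \<union> set (snd t))"

lemma tape_symbols_act: "tape_symbols (tape_act (a, m) t) \<subseteq> insert a (tape_symbols t)"
proof -
  obtain l r where t: "t = (l, r)" by (cases t)
  show ?thesis
    unfolding t
    by (cases m; cases l; cases r) (auto simp: tape_symbols_def tape_act_def)
qed

lemma tape_read_symbols: "tape_read t \<in> tape_symbols t"
  by (cases t rule: tape_read.cases) (auto simp: tape_symbols_def)

text \<open>The symbol bound is part of the invariant because \<open>wf_tm\<close> constrains
  transitions only on scanned words over the alphabet. Without it, \<open>acts\<close> might be too
  short and \<open>map2\<close> would drop tapes.\<close>

fun conf_rel :: "turing_machine \<Rightarrow> nat \<times> tape list \<Rightarrow> nat \<times> aconf \<Rightarrow> bool" where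
  "conf_rel M (q, ts) (q', c) \<longleftrightarrow> q = q' \<and> length ts = num_tapes M \<and>
     (\<forall>i < num_tapes M. c i = abs_tape (ts ! i) \<and> tape_symbols (ts ! i) \<subseteq> {..<num_symbols M})"

lemma conf_rel_step:
  assumes wf: "wf_tm M" and R: "conf_rel M C D"
  shows "conf_rel M (tm_step M C) (astep M D)"
proof -
  obtain q ts where C: "C = (q, ts)" by (cases C)
  obtain c where D: "D = (q, c)" using R C by (cases D) auto
  have R: "length ts = num_tapes M"
    "\<And>i. i < num_tapes M \<Longrightarrow> c i = abs_tape (ts ! i)"
    "\<And>i. i < num_tapes M \<Longrightarrow> tape_symbols (ts ! i) \<subseteq> {..<num_symbols M}"
    using R by (auto simp: C D)
  show ?thesis
  proof (cases "q < num_states M")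
    case False
    then show ?thesis using R by (simp add: C D)
  next
    case True
    have as: "map (\<lambda>i. aread (c i)) [0..<num_tapes M] = map tape_read ts"
      using R by (auto intro!: nth_equalityI simp: aread_abs)
    obtain q' acts where tr: "transition M q (map tape_read ts) = (q', acts)"
      by (cases "transition M q (map tape_read ts)")
    have "set (map tape_read ts) \<subseteq> {..<num_symbols M}"
    proof
      fix a assume "a \<in> set (map tape_read ts)"
      then obtain i where i: "i < num_tapes M" "a = tape_read (ts ! i)"
        using R by (auto simp: in_set_conv_nth)
      then show "a \<in> {..<num_symbols M}"
        using R tape_read_symbols[of "ts ! i"] by blast
    qed
    moreover have "length (map tape_read ts) = num_tapes M" using R by simp
    ultimately have *: "q < num_states M \<and> length (map tape_read ts) = num_tapes M \<and>
        set (map tape_read ts) \<subseteq> {..<num_symbols M}"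
      using True by blast
    have acts: "length acts = num_tapes M" "\<forall>(a, d) \<in> set acts. a < num_symbols M"
      using wf[unfolded wf_tm_def, THEN conjunct2, THEN conjunct2, rule_format, OF *]
      by (simp_all add: tr)
    have sub: "tape_symbols (tape_act (acts ! i) (ts ! i)) \<subseteq> {..<num_symbols M}"
      if "i < num_tapes M" for i
    proof -
      obtain a m where am: "acts ! i = (a, m)" by (cases "acts ! i")
      have "(a, m) \<in> set acts" using nth_mem[of i acts] am acts(1) that by simp
      then have "a < num_symbols M" using acts(2) by auto
      then show ?thesis
        using tape_symbols_act[of a m "ts ! i"] R that by (auto simp: am)
    qed
    have "tm_step M C = (q', map2 tape_act acts ts)"
      using True by (simp add: C tr)
    moreover have "astep M D = (q', \<lambda>i. if i < num_tapes M then aact (acts ! i) (c i) else c i)"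
      using True by (simp add: D as tr)
    ultimately show ?thesis
      using R acts(1) sub by (simp add: aact_abs)
  qed
qed

lemma conf_rel_steps:
  assumes "wf_tm M" "conf_rel M C D"
  shows "conf_rel M ((tm_step M ^^ t) C) ((astep M ^^ t) D)"
  using assms by (induction t) (auto intro: conf_rel_step)

definition start_conf :: "nat list \<Rightarrow> aconf" where
  "start_conf x = (\<lambda>i. tp [] [])(0 := tp [] x)"

lemma conf_rel_init:
  assumes "wf_tm M" "set x \<subseteq> {..<5}"
  shows "conf_rel M (tm_init M x) (0, start_conf x)"
  using assms
  by (auto simp: tm_init_def wf_tm_def start_conf_def nth_Cons abs_tape_def tape_symbols_def
      split: nat.splits)

text \<open>The number of steps is existential: inside a larger machine the final state of
  \<open>M\<close> is no longer halting, so a run cannot be padded by idling there.\<close>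

definition exec :: "turing_machine \<Rightarrow> aconf \<Rightarrow> aconf \<Rightarrow> nat \<Rightarrow> bool" where
  "exec M c c' t \<longleftrightarrow> (\<exists>t' \<le> t. (astep M ^^ t') (0, c) = (num_states M, c'))"

lemma exec_mono: "exec M c c' t \<Longrightarrow> t \<le> t' \<Longrightarrow> exec M c c' t'"
  unfolding exec_def by (meson le_trans)

lemma astep_halted: "num_states M \<le> q \<Longrightarrow> (astep M ^^ t) (q, c) = (q, c)"
  by (induction t) auto

lemma tm_step_halted: "(tm_step M ^^ t) (num_states M, ts) = (num_states M, ts)"
  by (induction t) auto

lemma tm_computes_within_exec:
  assumes "wf_tm M" "set x \<subseteq> {..<5}" "exec M (start_conf x) c t" "c 0 = tp l y" "0 \<notin> set y"
  shows "tm_computes_within M x y t"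
proof -
  obtain t' where t': "t' \<le> t" "(astep M ^^ t') (0, start_conf x) = (num_states M, c)"
    using assms(3) by (auto simp: exec_def)
  have R: "conf_rel M ((tm_step M ^^ t') (tm_init M x)) (num_states M, c)"
    using conf_rel_steps[OF assms(1) conf_rel_init[OF assms(1,2)], of t'] t'(2) by simp
  then obtain ts where ts: "(tm_step M ^^ t') (tm_init M x) = (num_states M, ts)"
    by (cases "(tm_step M ^^ t') (tm_init M x)") auto
  have "(tm_step M ^^ t) (tm_init M x) = (tm_step M ^^ (t - t')) ((tm_step M ^^ t') (tm_init M x))"
    using t'(1) funpow_add[of "t - t'" t' "tm_step M"] by simp
  then have t: "(tm_step M ^^ t) (tm_init M x) = (num_states M, ts)"
    by (simp add: ts tm_step_halted)
  have "1 \<le> num_tapes M" using assms(1) by (simp add: wf_tm_def)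
  then have "abs_tape (ts ! 0) = tp l y" using R assms(4) by (simp add: ts)
  then have "takeWhile (\<lambda>a. a \<noteq> 0) (snd (ts ! 0)) = takeWhile (\<lambda>a. a \<noteq> 0) y"
    by (intro takeWhile_nonblank) (simp add: abs_tape_def tp_def)
  also have "\<dots> = y" using assms(5) by (intro takeWhile_eq_all_conv[THEN iffD2]) (metis)
  finally show ?thesis by (simp add: tm_computes_within_def t)
qed

text \<open>About the final configuration only this is known: the word \<open>y\<close> starts at
  the head and is followed by a blank. The cells in \<open>l\<close>, the rest of \<open>r\<close>
  and all other tapes are arbitrary.\<close>

lemma exec_of_tm_computes_within:
  assumes "wf_tm M" "set x \<subseteq> {..<5}" "tm_computes_within M x y t"
  obtains c l r where "exec M (start_conf x) c t" "c 0 = tp l (y @ r)" "aread (tp [] r) = 0"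
proof -
  obtain ts where ts: "(tm_step M ^^ t) (tm_init M x) = (num_states M, ts)"
    and y: "takeWhile (\<lambda>a. a \<noteq> 0) (snd (ts ! 0)) = y"
    using assms(3) by (auto simp: tm_computes_within_def split: prod.splits)
  have R: "conf_rel M (num_states M, ts) ((astep M ^^ t) (0, start_conf x))"
    using conf_rel_steps[OF assms(1) conf_rel_init[OF assms(1,2)], of t] ts by simp
  then obtain c where c: "(astep M ^^ t) (0, start_conf x) = (num_states M, c)"
    by (cases "(astep M ^^ t) (0, start_conf x)") auto
  let ?r = "dropWhile (\<lambda>a. a \<noteq> 0) (snd (ts ! 0))"
  have "1 \<le> num_tapes M" using assms(1) by (simp add: wf_tm_def)
  then have "c 0 = tp (fst (ts ! 0)) (y @ ?r)"
    using R unfolding y[symmetric] by (simp add: c abs_tape_def)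
  moreover have "aread (tp [] ?r) = 0"
  proof (cases "dropWhile (\<lambda>a. a \<noteq> 0) (snd (ts ! 0))")
    case Nil
    show ?thesis unfolding Nil by simp
  next
    case (Cons a r)
    then have "a = 0" using hd_dropWhile[of "\<lambda>a. a \<noteq> 0" "snd (ts ! 0)"] by force
    then show ?thesis unfolding Cons by simp
  qed
  ultimately show ?thesis using that c by (auto simp: exec_def)
qed

text \<open>The simulation argument shared by \<open>seq\<close>, \<open>whl\<close> and
  \<open>ite\<close>. The hypotheses speak only of states below \<open>num_states M\<close>, so the
  image of the halting state is free: it becomes the start of the next program, the loop test or the
  common end.\<close>

lemma astep_embed:
  assumes tapes: "num_tapes M' = num_tapes M"
    and lt: "\<And>q. q < num_states M \<Longrightarrow> h q < num_states M'"
    and tr: "\<And>q as. q < num_states M \<Longrightarrow> transition M' (h q) as = apfst h (transition M q as)"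
    and run: "(astep M ^^ t) (q, c) = (num_states M, c')"
  shows "\<exists>t' \<le> t. (astep M' ^^ t') (h q, c) = (h (num_states M), c')"
  using run
proof (induction t arbitrary: q c)
  case 0
  then show ?case by auto
next
  case (Suc t)
  show ?case
  proof (cases "q < num_states M")
    case False
    then have "q = num_states M \<and> c = c'"
      using Suc.prems astep_halted[of M q "Suc t" c] by auto
    then show ?thesis by (intro exI[of _ 0]) auto
  next
    case True
    obtain q1 c1 where st: "astep M (q, c) = (q1, c1)" by (cases "astep M (q, c)")
    have "(astep M ^^ t) (q1, c1) = (num_states M, c')"
      using Suc.prems by (simp add: funpow_Suc_right st del: funpow.simps astep.simps)
    then obtain t' where t': "t' \<le> t" "(astep M' ^^ t') (h q1, c1) = (h (num_states M), c')"
      using Suc.IH by blast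
    have "astep M' (h q, c) = (h q1, c1)"
      using st True lt[OF True] tr[OF True] tapes by (auto split: prod.splits)
    then have "(astep M' ^^ Suc t') (h q, c) = (h (num_states M), c')"
      using t'(2) by (simp add: funpow_Suc_right del: funpow.simps astep.simps)
    then show ?thesis using t'(1) by (intro exI[of _ "Suc t'"]) auto
  qed
qed

lemma exec_trans_embed:
  assumes "(astep M ^^ t1) (q0, c) = (q1, c1)" "t1 \<le> T1"
    and "\<exists>t2 \<le> T2. (astep M ^^ t2) (q1, c1) = (q2, c2)"
  shows "\<exists>t \<le> T1 + T2. (astep M ^^ t) (q0, c) = (q2, c2)"
proof -
  obtain t2 where t2: "t2 \<le> T2" "(astep M ^^ t2) (q1, c1) = (q2, c2)" using assms by blast
  then have "(astep M ^^ (t2 + t1)) (q0, c) = (q2, c2)"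
    using assms(1) by (simp add: funpow_add)
  then show ?thesis using t2(1) assms(2) by (intro exI[of _ "t2 + t1"]) auto
qed

section \<open>Structured programs\<close>

text \<open>Machines can be composed only if they agree on the number \<open>K\<close> of tapes and
  the number \<open>s\<close> of symbols, so both are fixed. The programs below work on tapes 0 to 4
  and write symbols up to 4, whence the bounds.\<close>

locale machine_combinators =
  fixes K s :: nat
  assumes K5: "5 \<le> K" and s5: "5 \<le> s"
begin

definition good :: "turing_machine \<Rightarrow> bool" where
  "good M \<longleftrightarrow> wf_tm M \<and> num_tapes M = K \<and> num_symbols M = s"

lemma good_iff:
  "good M \<longleftrightarrow> num_tapes M = K \<and> num_symbols M = s \<and>
    (\<forall>q as. q < num_states M \<and> length as = K \<and> set as \<subseteq> {..<s} \<longrightarrow>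
      (case transition M q as of (q', acts) \<Rightarrow>
        q' \<le> num_states M \<and> length acts = K \<and> (\<forall>(a, d) \<in> set acts. a < s)))"
  using K5 s5 unfolding good_def wf_tm_def by auto

lemma goodE:
  assumes "good M" "q < num_states M" "length as = K" "set as \<subseteq> {..<s}"
  obtains q' acts where "transition M q as = (q', acts)" "q' \<le> num_states M" "length acts = K"
    "\<forall>(a, d) \<in> set acts. a < s"
proof -
  obtain q' acts where tr: "transition M q as = (q', acts)" by (cases "transition M q as")
  have *: "q < num_states M \<and> length as = K \<and> set as \<subseteq> {..<s}"
    using assms by blast
  show ?thesis
    by (rule that[OF tr])
       (use assms(1)[unfolded good_iff, THEN conjunct2, THEN conjunct2, rule_format, OF *]
        in \<open>simp_all add: tr\<close>)
qed

text \<open>Programs refer to scanned symbols by tape index instead of by position in a list.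
  \<open>scanned\<close> is the counterpart on configurations, and \<open>lookup_map\<close> matches
  the two.\<close>

definition lookup :: "nat list \<Rightarrow> nat \<Rightarrow> nat" where
  "lookup as i = (if i < K then as ! i else 0)"

definition scanned :: "aconf \<Rightarrow> nat \<Rightarrow> nat" where
  "scanned c i = (if i < K then aread (c i) else 0)"

lemma lookup_map: "lookup (map (\<lambda>i. aread (c i)) [0..<K]) = scanned c"
  by (auto simp: lookup_def scanned_def)

lemma scanned_simps [simp]:
  "scanned c 0 = aread (c 0)" "scanned c (Suc 0) = aread (c (Suc 0))" "scanned c 2 = aread (c 2)"
  "scanned c 3 = aread (c 3)" "scanned c 4 = aread (c 4)"
  using K5 by (auto simp: scanned_def)

definition idle :: "nat list \<Rightarrow> (nat \<times> move) list" where
  "idle as = map (\<lambda>a. (a, Stay)) as"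

lemma idle_conf: "i < K \<Longrightarrow> aact (idle (map (\<lambda>i. aread (c i)) [0..<K]) ! i) (c i) = c i"
  by (simp add: idle_def)

type_synonym update = "nat \<times> ((nat \<Rightarrow> nat) \<Rightarrow> nat \<times> move)"

definition act :: "update list \<Rightarrow> turing_machine" where
  "act us = \<lparr>num_tapes = K, num_states = 1, num_symbols = s,
     transition = \<lambda>q as. (1, map (\<lambda>i. case map_of us i of
        None \<Rightarrow> (as ! i, Stay) | Some g \<Rightarrow> g (lookup as)) [0..<K])\<rparr>"

text \<open>All updates see the configuration before the step. Hence
  \<open>apply_updates_simps\<close> can peel them off one at a time without changing what the
  others read.\<close>

definition apply_updates :: "update list \<Rightarrow> aconf \<Rightarrow> aconf" where
  "apply_updates us c = (\<lambda>i. case map_of us i of None \<Rightarrow> c i | Some g \<Rightarrow> aact (g (scanned c)) (c i))"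

lemma apply_updates_simps [simp]:
  "apply_updates [] c = c"
  "apply_updates ((i, g) # us) c = (apply_updates us c)(i := aact (g (scanned c)) (c i))"
  by (auto simp: apply_updates_def)

lemma exec_act:
  assumes "fst ` set us \<subseteq> {..<5}" "apply_updates us c = c'"
  shows "exec (act us) c c' 1"
proof -
  have none: "map_of us i = None" if "\<not> i < K" for i
  proof (rule ccontr)
    assume "map_of us i \<noteq> None"
    then have "i \<in> fst ` set us" by (simp add: map_of_eq_None_iff)
    then show False using assms(1) K5 that by auto
  qed
  let ?h = "\<lambda>i. case map_of us i of None \<Rightarrow> (aread (c i), Stay) | Some g \<Rightarrow> g (scanned c)"
  have "num_tapes (act us) = K" "0 < num_states (act us)" by (simp_all add: act_def)
  moreover have "transition (act us) 0 (map (\<lambda>i. aread (c i)) [0..<K]) = (1, map ?h [0..<K])"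
    by (simp add: act_def lookup_map split: option.split)
  ultimately have "astep (act us) (0, c) =
      (1, \<lambda>i. if i < K then aact (map ?h [0..<K] ! i) (c i) else c i)"
    by simp
  also have "(\<lambda>i. if i < K then aact (map ?h [0..<K] ! i) (c i) else c i) = c'"
    unfolding assms(2)[symmetric]
  proof
    fix i show "(if i < K then aact (map ?h [0..<K] ! i) (c i) else c i) = apply_updates us c i"
      using none[of i] by (cases "map_of us i") (auto simp: apply_updates_def)
  qed
  finally have "astep (act us) (0, c) = (1, c')" .
  then have "(astep (act us) ^^ 1) (0, c) = (num_states (act us), c')"
    by (simp add: act_def del: astep.simps)
  then show ?thesis
    unfolding exec_def by blast
qed

lemma good_act:
  assumes "\<And>i g f. (i, g) \<in> set us \<Longrightarrow> (\<And>j. f j < s) \<Longrightarrow> fst (g f) < s"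
  shows "good (act us)"
  unfolding good_iff
proof (intro conjI allI impI)
  fix q as assume as: "q < num_states (act us) \<and> length as = K \<and> set as \<subseteq> {..<s}"
  have look: "lookup as j < s" for j
    using as s5 by (auto simp: lookup_def subset_iff)
  have "fst (case map_of us i of None \<Rightarrow> (as ! i, Stay) | Some g \<Rightarrow> g (lookup as)) < s"
    if "i < K" for i
    using as that assms[OF map_of_SomeD look] by (auto split: option.splits simp: subset_iff)
  then show "case transition (act us) q as of (q', acts) \<Rightarrow>
        q' \<le> num_states (act us) \<and> length acts = K \<and> (\<forall>(a, d) \<in> set acts. a < s)"
    by (force simp: act_def)
qed (auto simp: act_def)

section \<open>Sequencing, loops and branches\<close>

definition seq :: "turing_machine \<Rightarrow> turing_machine \<Rightarrow> turing_machine" (infixr ";;" 60) where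
  "M1 ;; M2 = \<lparr>num_tapes = K, num_states = num_states M1 + num_states M2, num_symbols = s,
     transition = \<lambda>q as. if q < num_states M1 then transition M1 q as
       else apfst ((+) (num_states M1)) (transition M2 (q - num_states M1) as)\<rparr>"

text \<open>The halting state of \<open>M1\<close> is at the same time the start state of
  \<open>M2\<close>, so passing control costs no step and the times simply add up.\<close>

lemma exec_seq:
  assumes "good M1" "good M2" "exec M1 c c1 t1" "exec M2 c1 c2 t2" "t1 + t2 \<le> t"
  shows "exec (M1 ;; M2) c c2 t"
proof -
  let ?M = "M1 ;; M2"
  obtain u1 where u1: "u1 \<le> t1" "(astep M1 ^^ u1) (0, c) = (num_states M1, c1)"
    using assms by (auto simp: exec_def)
  obtain u2 where u2: "u2 \<le> t2" "(astep M2 ^^ u2) (0, c1) = (num_states M2, c2)"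
    using assms by (auto simp: exec_def)
  have "\<exists>t'\<le>u1. (astep ?M ^^ t') (id 0, c) = (id (num_states M1), c1)"
    by (rule astep_embed[OF _ _ _ u1(2)])
       (use assms in \<open>auto simp: seq_def good_iff apfst_def map_prod_def split: prod.splits\<close>)
  then obtain t' where t': "t' \<le> u1" "(astep ?M ^^ t') (0, c) = (num_states M1, c1)"
    by auto
  have "\<exists>t'\<le>u2. (astep ?M ^^ t') (num_states M1 + 0, c1) = (num_states M1 + num_states M2, c2)"
    by (rule astep_embed[OF _ _ _ u2(2), where h = "(+) (num_states M1)"])
       (use assms in \<open>auto simp: seq_def good_iff\<close>)
  then have "\<exists>t'\<le>u2. (astep ?M ^^ t') (num_states M1, c1) = (num_states ?M, c2)"
    by (simp add: seq_def)
  from exec_trans_embed[OF t'(2) t'(1) this]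
  have "exec ?M c c2 (u1 + u2)" by (simp add: exec_def)
  then show ?thesis by (rule exec_mono) (use u1(1) u2(1) assms(5) in linarith)
qed

lemma good_seq [simp]:
  assumes "good M1" "good M2"
  shows "good (M1 ;; M2)"
  unfolding good_iff
proof (intro conjI allI impI)
  fix q as assume as: "q < num_states (M1 ;; M2) \<and> length as = K \<and> set as \<subseteq> {..<s}"
  show "case transition (M1 ;; M2) q as of (q', acts) \<Rightarrow>
        q' \<le> num_states (M1 ;; M2) \<and> length acts = K \<and> (\<forall>(a, d) \<in> set acts. a < s)"
  proof (cases "q < num_states M1")
    case True
    obtain q' acts where "transition M1 (q) as = (q', acts)"
      "q' \<le> num_states M1" "length acts = K" "\<forall>(a, d) \<in> set acts. a < s"
      using goodE[OF assms(1) True] as by blast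
    with True as show ?thesis by (auto simp: seq_def)
  next
    case False
    then have "q - num_states M1 < num_states M2" using as by (auto simp: seq_def)
    obtain q' acts where "transition M2 (q - num_states M1) as = (q', acts)"
      "q' \<le> num_states M2" "length acts = K" "\<forall>(a, d) \<in> set acts. a < s"
      using goodE[OF assms(2) \<open>q - num_states M1 < num_states M2\<close>] as by blast
    with False as show ?thesis by (auto simp: seq_def)
  qed
qed (auto simp: seq_def)

definition while_state :: "turing_machine \<Rightarrow> nat \<Rightarrow> nat" where
  "while_state M q = (if q = num_states M then 0 else Suc q)"

definition whl :: "((nat \<Rightarrow> nat) \<Rightarrow> bool) \<Rightarrow> turing_machine \<Rightarrow> turing_machine" where
  "whl b M = \<lparr>num_tapes = K, num_states = Suc (num_states M), num_symbols = s,
     transition = \<lambda>q as.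
       if q = 0 then (if b (lookup as) then while_state M 0 else Suc (num_states M), idle as)
       else apfst (while_state M) (transition M (q - 1) as)\<rparr>"

lemma astep_whl_test:
  "astep (whl b M) (0, c) =
    (if b (scanned c) then while_state M 0 else num_states (whl b M), c)"
  by (auto simp: whl_def lookup_map fun_eq_iff idle_conf)

lemma exec_whl_False: "\<not> b (scanned c) \<Longrightarrow> exec (whl b M) c c 1"
  unfolding exec_def
  by (intro exI[of _ 1]) (auto simp: astep_whl_test simp del: astep.simps)

text \<open>The strict inequality pays for the step in which state 0 evaluates the test. The end of
  the body is identified with state 0, so the way back is free.\<close>

lemma exec_whl_True:
  assumes "good M" "b (scanned c)" "exec M c c1 t1" "exec (whl b M) c1 c2 t2" "t1 + t2 < t"
  shows "exec (whl b M) c c2 t"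
proof -
  let ?M = "whl b M"
  obtain u1 where u1: "u1 \<le> t1" "(astep M ^^ u1) (0, c) = (num_states M, c1)"
    using assms by (auto simp: exec_def)
  have "\<exists>t'\<le>u1. (astep ?M ^^ t') (while_state M 0, c) = (while_state M (num_states M), c1)"
    by (rule astep_embed[OF _ _ _ u1(2)])
       (use assms in \<open>auto simp: whl_def good_iff while_state_def\<close>)
  then obtain t' where t': "t' \<le> u1" "(astep ?M ^^ t') (while_state M 0, c) = (0, c1)"
    by (auto simp: while_state_def)
  have "(astep ?M ^^ Suc t') (0, c) = (0, c1)"
    using t'(2) assms(2)
    by (simp add: funpow_Suc_right astep_whl_test del: funpow.simps astep.simps)
  from exec_trans_embed[OF this le_refl assms(4)[unfolded exec_def]]
  have "exec ?M c c2 (Suc t' + t2)" by (simp add: exec_def)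
  then show ?thesis by (rule exec_mono) (use u1(1) t'(1) assms(5) in linarith)
qed

lemma good_whl [simp]:
  assumes "good M"
  shows "good (whl b M)"
  unfolding good_iff
proof (intro conjI allI impI)
  fix q as assume as: "q < num_states (whl b M) \<and> length as = K \<and> set as \<subseteq> {..<s}"
  show "case transition (whl b M) q as of (q', acts) \<Rightarrow>
        q' \<le> num_states (whl b M) \<and> length acts = K \<and> (\<forall>(a, d) \<in> set acts. a < s)"
  proof (cases "q = 0")
    case True
    then show ?thesis
      using as by (auto simp: whl_def while_state_def idle_def)
  next
    case False
    then have "q - 1 < num_states M" using as by (auto simp: whl_def)
    obtain q' acts where "transition M (q - 1) as = (q', acts)"
      "q' \<le> num_states M" "length acts = K" "\<forall>(a, d) \<in> set acts. a < s"
      using goodE[OF assms \<open>q - 1 < num_states M\<close>] as by blast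
    with False as show ?thesis by (auto simp: whl_def while_state_def)
  qed
qed (auto simp: whl_def)

definition ite_state :: "turing_machine \<Rightarrow> turing_machine \<Rightarrow> nat \<Rightarrow> nat" where
  "ite_state M1 M2 q = (if q = num_states M1 then Suc (num_states M1 + num_states M2) else Suc q)"

definition ite :: "((nat \<Rightarrow> nat) \<Rightarrow> bool) \<Rightarrow> turing_machine \<Rightarrow> turing_machine \<Rightarrow> turing_machine"
  where
  "ite b M1 M2 = \<lparr>num_tapes = K, num_states = Suc (num_states M1 + num_states M2),
     num_symbols = s,
     transition = \<lambda>q as.
       if q = 0 then (if b (lookup as) then ite_state M1 M2 0 else Suc (num_states M1), idle as)
       else if q \<le> num_states M1 then apfst (ite_state M1 M2) (transition M1 (q - 1) as)
       else apfst (\<lambda>q. Suc (num_states M1) + q) (transition M2 (q - Suc (num_states M1)) as)\<rparr>"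

lemma astep_ite_test:
  "astep (ite b M1 M2) (0, c) =
    (if b (scanned c) then ite_state M1 M2 0 else Suc (num_states M1), c)"
  by (auto simp: ite_def lookup_map fun_eq_iff idle_conf)

lemma exec_ite_True:
  assumes "good M1" "b (scanned c)" "exec M1 c c1 t1" "t1 < t"
  shows "exec (ite b M1 M2) c c1 t"
proof -
  let ?M = "ite b M1 M2"
  obtain u1 where u1: "u1 \<le> t1" "(astep M1 ^^ u1) (0, c) = (num_states M1, c1)"
    using assms by (auto simp: exec_def)
  have "\<exists>t'\<le>u1. (astep ?M ^^ t') (ite_state M1 M2 0, c) = (ite_state M1 M2 (num_states M1), c1)"
    by (rule astep_embed[OF _ _ _ u1(2)])
       (use assms in \<open>auto simp: ite_def good_iff ite_state_def\<close>)
  then obtain t' where "t' \<le> u1" "(astep ?M ^^ t') (ite_state M1 M2 0, c) = (num_states ?M, c1)"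
    by (auto simp: ite_state_def ite_def)
  moreover from this(2) have "(astep ?M ^^ Suc t') (0, c) = (num_states ?M, c1)"
    using assms(2) by (simp add: funpow_Suc_right astep_ite_test del: funpow.simps astep.simps)
  ultimately show ?thesis
    using u1(1) assms(4) unfolding exec_def by (intro exI[of _ "Suc t'"]) auto
qed

lemma exec_ite_False:
  assumes "good M2" "\<not> b (scanned c)" "exec M2 c c1 t1" "t1 < t"
  shows "exec (ite b M1 M2) c c1 t"
proof -
  let ?M = "ite b M1 M2"
  obtain u1 where u1: "u1 \<le> t1" "(astep M2 ^^ u1) (0, c) = (num_states M2, c1)"
    using assms by (auto simp: exec_def)
  have "\<exists>t'\<le>u1. (astep ?M ^^ t') (Suc (num_states M1) + 0, c)
      = (Suc (num_states M1) + num_states M2, c1)"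
    by (rule astep_embed[OF _ _ _ u1(2), where h = "\<lambda>q. Suc (num_states M1) + q"])
       (use assms in \<open>auto simp: ite_def good_iff\<close>)
  then obtain t' where "t' \<le> u1" "(astep ?M ^^ t') (Suc (num_states M1), c) = (num_states ?M, c1)"
    by (auto simp: ite_def)
  moreover from this(2) have "(astep ?M ^^ Suc t') (0, c) = (num_states ?M, c1)"
    using assms(2) by (simp add: funpow_Suc_right astep_ite_test del: funpow.simps astep.simps)
  ultimately show ?thesis
    using u1(1) assms(4) unfolding exec_def by (intro exI[of _ "Suc t'"]) auto
qed

lemma good_ite [simp]:
  assumes "good M1" "good M2"
  shows "good (ite b M1 M2)"
  unfolding good_iff
proof (intro conjI allI impI)
  let ?M = "ite b M1 M2"
  fix q as assume as: "q < num_states ?M \<and> length as = K \<and> set as \<subseteq> {..<s}"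
  consider "q = 0" | "0 < q" "q \<le> num_states M1" | "num_states M1 < q" by linarith
  then show "case transition ?M q as of (q', acts) \<Rightarrow>
        q' \<le> num_states ?M \<and> length acts = K \<and> (\<forall>(a, d) \<in> set acts. a < s)"
  proof cases
    case 1
    then show ?thesis
      using as by (auto simp: ite_def ite_state_def idle_def)
  next
    case 2
    then have "q - 1 < num_states M1" by auto
    obtain q' acts where "transition M1 (q - 1) as = (q', acts)"
      "q' \<le> num_states M1" "length acts = K" "\<forall>(a, d) \<in> set acts. a < s"
      using goodE[OF assms(1) \<open>q - 1 < num_states M1\<close>] as by blast
    with 2 as show ?thesis by (auto simp: ite_def ite_state_def)
  next
    case 3
    then have "q - Suc (num_states M1) < num_states M2" using as by (auto simp: ite_def)
    obtain q' acts where "transition M2 (q - Suc (num_states M1)) as = (q', acts)"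
      "q' \<le> num_states M2" "length acts = K" "\<forall>(a, d) \<in> set acts. a < s"
      using goodE[OF assms(2) \<open>q - Suc (num_states M1) < num_states M2\<close>] as by blast
    with 3 as show ?thesis by (auto simp: ite_def)
  qed
qed (auto simp: ite_def)

end

section \<open>Binary arithmetic on lists of symbols\<close>

text \<open>The symbols 1 and 2 stand for the bits 0 and 1, hence the \<open>a - 1\<close>.\<close>

fun bits_value :: "nat list \<Rightarrow> nat" where
  "bits_value [] = 0"
| "bits_value (a # xs) = (a - 1) + 2 * bits_value xs"

lemma bits_0 [simp]: "bits 0 = []"
  by (simp add: bits.simps)

lemma bits_value_bits [simp]: "bits_value (bits k) = k"
proof (induction k rule: less_induct)
  case (less k)
  then show ?case
    by (cases "k = 0") (simp_all add: bits.simps[of k])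
qed

lemma bits_symbols: "set (bits k) \<subseteq> {1, 2}"
proof (induction k rule: less_induct)
  case (less k)
  then show ?case
    by (cases "k = 0") (auto simp: bits.simps[of k])
qed

lemma bits_ne [simp]: "0 \<notin> set (bits k)" "3 \<notin> set (bits k)" "4 \<notin> set (bits k)"
  using bits_symbols[of k] by auto

lemma last_bits: "0 < k \<Longrightarrow> last (bits k) = 2"
proof (induction k rule: less_induct)
  case (less k)
  show ?case
  proof (cases "k = 1")
    case True
    then show ?thesis by (simp add: bits.simps)
  next
    case False
    then have "0 < k div 2" "k div 2 < k" using less.prems by auto
    moreover from this(1) have "bits (k div 2) \<noteq> []" by (simp add: bits.simps[of "k div 2"])
    ultimately show ?thesis using less by (simp add: bits.simps[of k])
  qed
qed

lemma bits_bits_value: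
  assumes "set xs \<subseteq> {1, 2}"
  shows "\<exists>n. xs = bits (bits_value xs) @ replicate n 1"
  using assms
proof (induction xs)
  case Nil
  then show ?case by simp
next
  case (Cons a xs)
  then obtain n where n: "xs = bits (bits_value xs) @ replicate n 1" by auto
  show ?case
  proof (cases "bits_value (a # xs) = 0")
    case True
    then have "a = 1" "bits_value xs = 0" using Cons.prems by auto
    then show ?thesis using n by (intro exI[of _ "Suc n"]) (simp add: n[symmetric])
  next
    case False
    have "bits_value (a # xs) mod 2 = a - 1" "bits_value (a # xs) div 2 = bits_value xs"
      using Cons.prems by auto
    then have "bits (bits_value (a # xs)) = a # bits (bits_value xs)"
      using False Cons.prems by (subst bits.simps) auto
    then show ?thesis using n by auto
  qed
qed

lemma length_bits_mono: "k \<le> m \<Longrightarrow> length (bits k) \<le> length (bits m)"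
proof (induction k arbitrary: m rule: less_induct)
  case (less k)
  show ?case
  proof (cases "k = 0")
    case False
    then have "length (bits (k div 2)) \<le> length (bits (m div 2))"
      using less by (simp add: div_le_mono)
    then show ?thesis using False less.prems by (simp add: bits.simps[of k] bits.simps[of m])
  qed simp
qed

text \<open>The bit of a scanned cell; blanks and separators count as 0.\<close>

definition digit :: "nat \<Rightarrow> nat" where
  "digit a = (if a = 2 then 1 else 0)"

text \<open>The symbol under the head when the list is the remaining tape. An exhausted list shows
  the blank, whose \<open>digit\<close> is 0, so a shorter operand is padded with zeros.\<close>

definition hd0 :: "nat list \<Rightarrow> nat" where
  "hd0 l = (case l of [] \<Rightarrow> 0 | a # _ \<Rightarrow> a)"

lemma hd0_simps [simp]: "hd0 [] = 0" "hd0 (a # l) = a"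
  by (simp_all add: hd0_def)

lemma digit_simps [simp]: "digit 0 = 0" "digit (Suc 0) = 0" "digit 2 = 1" "digit 3 = 0"
  by (simp_all add: digit_def)

text \<open>The argument \<open>b\<close> is the borrow. Modulo 2 a difference equals a sum, so the
  digit of \<open>x - y - b\<close> is the parity of \<open>x + y + b\<close>.\<close>

fun sub_list :: "nat list \<Rightarrow> nat list \<Rightarrow> nat \<Rightarrow> nat list" where
  "sub_list [] ys b = []"
| "sub_list (x # xs) ys b = Suc ((digit x + digit (hd0 ys) + b) mod 2) #
     sub_list xs (tl ys) (if digit x < digit (hd0 ys) + b then 1 else 0)"

lemma sub_list_symbols: "set (sub_list xs ys b) \<subseteq> {1, 2}"
  by (induction xs ys b rule: sub_list.induct) auto

lemma length_sub_list [simp]: "length (sub_list xs ys b) = length xs"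
  by (induction xs ys b rule: sub_list.induct) auto

lemma bits_value_tl:
  assumes "set ys \<subseteq> {1, 2}"
  shows "bits_value ys = digit (hd0 ys) + 2 * bits_value (tl ys)"
  using assms by (cases ys) (auto simp: digit_def)

lemma sub_digit:
  fixes x y b :: nat
  assumes "x \<le> 1" "y \<le> 1" "b \<le> 1"
  shows "(x + y + b) mod 2 + y + b = x + 2 * (if x < y + b then 1 else 0)"
proof -
  have "x \<in> {0, 1}" "y \<in> {0, 1}" "b \<in> {0, 1}" using assms by auto
  then show ?thesis by (auto split: if_splits)
qed

lemma digit_le: "digit x \<le> 1"
  by (simp add: digit_def)

lemma val_sub_list:
  assumes "set xs \<subseteq> {1, 2}" "set ys \<subseteq> {1, 2}" "b \<le> 1" "bits_value ys + b \<le> bits_value xs"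
  shows "bits_value (sub_list xs ys b) + bits_value ys + b = bits_value xs"
  using assms
proof (induction xs arbitrary: ys b)
  case Nil
  then show ?case by simp
next
  case (Cons x xs)
  let ?y = "digit (hd0 ys)"
  define b' :: nat where "b' = (if digit x < ?y + b then 1 else 0)"
  have vx: "bits_value (x # xs) = digit x + 2 * bits_value xs" using Cons.prems(1) by (auto simp: digit_def)
  note vy = bits_value_tl[OF Cons.prems(2)]
  have d: "(digit x + ?y + b) mod 2 + ?y + b = digit x + 2 * b'"
    unfolding b'_def by (rule sub_digit) (use digit_le Cons.prems(3) in auto)
  \<comment> \<open>After a borrow the higher digits of \<open>xs\<close> must strictly exceed those
    of \<open>ys\<close>. Otherwise the low digits contribute at most 1, less than the unit 2 of the
    higher ones.\<close>
  have "bits_value (tl ys) + b' \<le> bits_value xs"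
    using Cons.prems(4) digit_le[of x] unfolding vx vy b'_def by (auto split: if_splits)
  moreover have "set (tl ys) \<subseteq> {1, 2}" using Cons.prems(2) by (cases ys) auto
  moreover have "b' \<le> 1" by (simp add: b'_def)
  ultimately have "bits_value (sub_list xs (tl ys) b') + bits_value (tl ys) + b' = bits_value xs"
    using Cons.IH[of "tl ys" b'] Cons.prems(1) by simp
  moreover have "bits_value (sub_list (x # xs) ys b) = (digit x + ?y + b) mod 2 + 2 * bits_value (sub_list xs (tl ys) b')"
    by (simp add: b'_def)
  ultimately show ?case using d vx vy by linarith
qed

function add_list :: "nat list \<Rightarrow> nat list \<Rightarrow> nat \<Rightarrow> nat list" where
  "add_list xs ys b = (if xs = [] \<and> ys = [] then [Suc b] else
     Suc ((digit (hd0 xs) + digit (hd0 ys) + b) mod 2) #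
       add_list (tl xs) (tl ys) (if 2 \<le> digit (hd0 xs) + digit (hd0 ys) + b then 1 else 0))"
  by auto
termination
proof (relation "measure (\<lambda>(xs, ys, b). length xs + length ys)")
  fix xs ys :: "nat list" and b :: nat
  assume "\<not> (xs = [] \<and> ys = [])"
  then show "((tl xs, tl ys, if 2 \<le> digit (hd0 xs) + digit (hd0 ys) + b then 1 else 0), xs, ys, b)
      \<in> measure (\<lambda>(xs, ys, b). length xs + length ys)"
    by (cases xs; cases ys) auto
qed simp

declare add_list.simps [simp del]

lemma add_carry:
  fixes m c x y b X Y A B :: nat
  assumes "m + 2 * c = x + y + b" "X = x + 2 * A" "Y = y + 2 * B"
  shows "m + 2 * (A + B + c) = X + Y + b"
  using assms by simp

lemma add_list_props:
  assumes "set xs \<subseteq> {1, 2}" "set ys \<subseteq> {1, 2}" "b \<le> 1"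
  shows "set (add_list xs ys b) \<subseteq> {1, 2} \<and> bits_value (add_list xs ys b) = bits_value xs + bits_value ys + b \<and>
    length (add_list xs ys b) = Suc (max (length xs) (length ys))"
  using assms
proof (induction xs ys b rule: add_list.induct)
  case (1 xs ys b)
  show ?case
  proof (cases "xs = [] \<and> ys = []")
    case True
    then show ?thesis using 1 by (auto simp: add_list.simps)
  next
    case False
    let ?n = "digit (hd0 xs) + digit (hd0 ys) + b"
    define b' :: nat where "b' = (if 2 \<le> ?n then 1 else 0)"
    have "?n \<in> {0, 1, 2, 3}"
      using digit_le[of "hd0 xs"] digit_le[of "hd0 ys"] "1.prems"(3) by auto
    then have n: "?n mod 2 + 2 * b' = ?n" unfolding b'_def by auto
    have "set (tl xs) \<subseteq> {1, 2}" "set (tl ys) \<subseteq> {1, 2}"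
      using "1.prems" by (cases xs; cases ys; simp)+
    moreover have "b' \<le> 1" by (simp add: b'_def)
    ultimately have IH: "set (add_list (tl xs) (tl ys) b') \<subseteq> {1, 2}"
      "bits_value (add_list (tl xs) (tl ys) b') = bits_value (tl xs) + bits_value (tl ys) + b'"
      "length (add_list (tl xs) (tl ys) b') = Suc (max (length (tl xs)) (length (tl ys)))"
      using "1.IH"[OF False] unfolding b'_def by blast+
    have eq: "add_list xs ys b = Suc (?n mod 2) # add_list (tl xs) (tl ys) b'"
      unfolding add_list.simps[of xs ys b] b'_def using False by (simp only: if_False)
    have "bits_value (add_list xs ys b) = ?n mod 2 + 2 * (bits_value (tl xs) + bits_value (tl ys) + b')"
      unfolding eq by (simp add: IH(2))
    also have "\<dots> = bits_value xs + bits_value ys + b"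
      by (rule add_carry[OF n bits_value_tl[OF "1.prems"(1)] bits_value_tl[OF "1.prems"(2)]])
    finally have "bits_value (add_list xs ys b) = bits_value xs + bits_value ys + b" .
    moreover have "length (add_list xs ys b) = Suc (max (length xs) (length ys))"
      unfolding eq using False IH(3) by (cases xs; cases ys) simp_all
    moreover have "set (add_list xs ys b) \<subseteq> {1, 2}" using IH(1) unfolding eq by auto
    ultimately show ?thesis by blast
  qed
qed

text \<open>The constant tail is the end of the numerator, the denominator 1 and its end. Integral
  weights thus spare the machine any reduction to lowest terms.\<close>

lemma enc_rat_of_nat: "enc_rat (of_nat v) = bits v @ [3, 2, 3]"
proof -
  have "quotient_of (of_nat v) = (int v, 1)"
    using quotient_of_int[of "int v"] by (simp add: Rat.of_int_def)
  moreover have "bits 1 = [2]" by (simp add: bits.simps)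
  ultimately show ?thesis by (simp add: enc_rat_def enc_nat_def)
qed

lemma aread_left: "aread (aact (b, MoveLeft) (tp l r)) = hd0 l"
  by (cases l; cases r) auto

lemma left_Cons: "aact (aread (tp (a # l) r), MoveLeft) (tp (a # l) r) = tp l (a # r)"
  by (cases r) (auto simp: tp_blank)

lemma left_erase: "aact (0, MoveLeft) (tp l [a]) = aact (0, MoveLeft) (tp l [])"
  by (cases l) auto

lemma aread_tp_hd0 [simp]: "aread (tp l r) = hd0 r"
  by (cases r) auto

declare tp_blank [simp]

context machine_combinators
begin

lemma small [simp]: "0 < s" "Suc 0 < s" "2 < s" "3 < s" "4 < s" "Suc (n mod 2) < s"
  using s5 by (auto intro: le_less_trans[OF _ less_le_trans[of 2 5]])

lemma good_act_Nil [simp]: "good (act [])"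
  by (rule good_act) simp

lemma good_act_Cons [simp]:
  assumes "good (act us)" "\<And>f. (\<forall>j. f j < s) \<Longrightarrow> fst (g f) < s"
  shows "good (act ((i, g) # us))"
proof -
  have 1: "num_tapes (act us') = K" "num_symbols (act us') = s" for us'
    by (simp_all add: act_def)
  show ?thesis
    unfolding good_iff
  proof (intro conjI allI impI)
    fix q as
    assume "q < num_states (act ((i, g) # us)) \<and> length as = K \<and> set as \<subseteq> {..<s}"
    then have q: "q < num_states (act us)" and as: "length as = K" "set as \<subseteq> {..<s}"
      by (auto simp: act_def)
    have "\<forall>j. lookup as j < s"
      using as s5 by (auto simp: lookup_def subset_iff)
    then have "fst (g (lookup as)) < s" by (rule assms(2))
    moreover obtain q' acts where "transition (act us) q as = (q', acts)"
      "\<forall>(a, d) \<in> set acts. a < s"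
      using goodE[OF assms(1) q as] by blast
    ultimately show "case transition (act ((i, g) # us)) q as of (q', acts) \<Rightarrow>
        q' \<le> num_states (act ((i, g) # us)) \<and> length acts = K \<and> (\<forall>(a, d) \<in> set acts. a < s)"
      by (force simp: act_def)
  qed (simp_all add: 1)
qed

lemma scanned_lt: "i < 5 \<Longrightarrow> scanned c i = aread (c i)"
  using K5 by (simp add: scanned_def)

text \<open>
  Tape 0 holds the input and later the output, tape 1 the start time, tape 2 the previous birthday
  of the current chain, and tape 3 a borrow or carry bit. Tape 4 is tape 0 of the machine for
  Min-WCS, whose further tapes are those from 5 on.
\<close>

definition cfg :: "atape \<Rightarrow> atape \<Rightarrow> atape \<Rightarrow> atape \<Rightarrow> atape \<Rightarrow> aconf \<Rightarrow> aconf" where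
  "cfg t0 t1 t2 t3 t4 R = (\<lambda>i. if i = 0 then t0 else if i = 1 then t1 else if i = 2 then t2
     else if i = 3 then t3 else if i = 4 then t4 else R i)"

lemma cfg_simps [simp]:
  "cfg t0 t1 t2 t3 t4 R 0 = t0" "cfg t0 t1 t2 t3 t4 R (Suc 0) = t1" "cfg t0 t1 t2 t3 t4 R 2 = t2"
  "cfg t0 t1 t2 t3 t4 R 3 = t3" "cfg t0 t1 t2 t3 t4 R 4 = t4"
  "(cfg t0 t1 t2 t3 t4 R)(0 := t) = cfg t t1 t2 t3 t4 R"
  "(cfg t0 t1 t2 t3 t4 R)(Suc 0 := t) = cfg t0 t t2 t3 t4 R"
  "(cfg t0 t1 t2 t3 t4 R)(2 := t) = cfg t0 t1 t t3 t4 R"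
  "(cfg t0 t1 t2 t3 t4 R)(3 := t) = cfg t0 t1 t2 t t4 R"
  "(cfg t0 t1 t2 t3 t4 R)(4 := t) = cfg t0 t1 t2 t3 t R"
  by (auto simp: cfg_def fun_eq_iff)

section \<open>Basic programs: head movement, stripping, copying, subtraction\<close>

definition move_head :: "nat \<Rightarrow> move \<Rightarrow> turing_machine" where
  "move_head i m = act [(i, \<lambda>f. (f i, m))]"

lemma good_move_head [simp]: "good (move_head i m)"
  unfolding move_head_def by (rule good_act) auto

lemma exec_move_head: "i < 5 \<Longrightarrow> c(i := aact (aread (c i), m) (c i)) = c' \<Longrightarrow> exec (move_head i m) c c' 1"
  unfolding move_head_def by (rule exec_act) (auto simp: scanned_lt)

definition goright :: "nat \<Rightarrow> (nat \<Rightarrow> bool) \<Rightarrow> turing_machine" where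
  "goright i P = whl (\<lambda>f. P (f i)) (move_head i MoveRight)"

lemma good_goright [simp]: "good (goright i P)"
  unfolding goright_def by (intro good_whl good_move_head)

text \<open>Each cell costs a test and a move, and the failing test at the end costs one more
  step.\<close>

lemma exec_goright:
  assumes "i < 5" "\<And>a. a \<in> set xs \<Longrightarrow> P a" "\<not> P (hd0 r)"
    "c i = tp l (xs @ r)" "c' = c(i := tp (rev xs @ l) r)" "2 * length xs < t"
  shows "exec (goright i P) c c' t"
  using assms(2-)
proof (induction xs arbitrary: c l t)
  case Nil
  have "exec (goright i P) c c 1"
    unfolding goright_def by (rule exec_whl_False) (use Nil assms(1) in \<open>simp add: scanned_lt\<close>)
  moreover have "c' = c" using Nil by (auto simp: fun_eq_iff)
  ultimately show ?case using exec_mono Nil by auto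
next
  case (Cons a xs)
  let ?c = "c(i := tp (a # l) (xs @ r))"
  have 1: "exec (move_head i MoveRight) c ?c 1"
    by (rule exec_move_head) (use assms(1) Cons.prems in auto)
  have 2: "exec (goright i P) ?c c' (2 * length xs + 1)"
    by (rule Cons.IH) (use Cons.prems in auto)
  show ?case
    unfolding goright_def
    by (rule exec_whl_True[OF good_move_head _ 1 2[unfolded goright_def]])
       (use Cons.prems assms(1) in \<open>auto simp: scanned_lt\<close>)
qed

text \<open>The head starts just behind a word and shall end on its first cell. The loop inspects
  the cells of the word from the right and stops one cell in front of it, which the last move
  repairs.\<close>

definition goleft :: "nat \<Rightarrow> (nat \<Rightarrow> bool) \<Rightarrow> turing_machine" where
  "goleft i P = move_head i MoveLeft ;; whl (\<lambda>f. P (f i)) (move_head i MoveLeft) ;; move_head i MoveRight"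

lemma good_goleft [simp]: "good (goleft i P)"
  unfolding goleft_def by (intro good_seq good_whl good_move_head)

text \<open>Both tapes are written as results of a left move, since their \<open>tp\<close> form
  depends on whether the lists are empty. The scanned symbol is still known, by
  \<open>aread_left\<close>.\<close>

lemma exec_goleft_loop:
  assumes "i < 5" "\<And>a. a \<in> set ls \<Longrightarrow> P a" "\<not> P (hd0 l)"
  shows "exec (whl (\<lambda>f. P (f i)) (move_head i MoveLeft))
     (c(i := aact (hd0 r, MoveLeft) (tp (ls @ l) r)))
     (c(i := aact (hd0 (rev ls @ r), MoveLeft) (tp l (rev ls @ r)))) (2 * length ls + 1)"
  using assms(2)
proof (induction ls arbitrary: r)
  case Nil
  let ?c = "c(i := aact (hd0 r, MoveLeft) (tp l r))"
  have "\<not> P (scanned ?c i)"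
    using assms by (simp add: scanned_lt aread_left del: aread_tp_hd0)
  from exec_whl_False[where b = "\<lambda>f. P (f i)" and M = "move_head i MoveLeft", OF this]
  show ?case by (simp only: rev.simps append_Nil list.size mult_0_right add_0_left)
next
  case (Cons a ls)
  let ?c = "c(i := aact (hd0 (a # r), MoveLeft) (tp (ls @ l) (a # r)))"
  have eq: "aact (hd0 r, MoveLeft) (tp ((a # ls) @ l) r) = tp (ls @ l) (a # r)"
    using left_Cons[of a "ls @ l" r] by simp
  have 1: "exec (move_head i MoveLeft) (c(i := tp (ls @ l) (a # r))) ?c 1"
    by (rule exec_move_head) (use assms(1) in auto)
  have 2: "exec (whl (\<lambda>f. P (f i)) (move_head i MoveLeft)) ?c
    (c(i := aact (hd0 (rev ls @ a # r), MoveLeft) (tp l (rev ls @ a # r)))) (2 * length ls + 1)"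
    by (rule Cons.IH) (use Cons.prems in auto)
  have "exec (whl (\<lambda>f. P (f i)) (move_head i MoveLeft)) (c(i := tp (ls @ l) (a # r)))
    (c(i := aact (hd0 (rev ls @ a # r), MoveLeft) (tp l (rev ls @ a # r)))) (2 * length (a # ls) + 1)"
    by (rule exec_whl_True[OF good_move_head _ 1 2])
       (use Cons.prems assms(1) in \<open>auto simp: scanned_lt\<close>)
  then show ?case
    unfolding eq by (simp only: rev.simps append_assoc append_Cons append_Nil)
qed

lemma exec_goleft:
  assumes "i < 5" "\<And>a. a \<in> set ls \<Longrightarrow> P a" "\<not> P (hd0 l)"
    "c i = tp (ls @ l) r" "c' = c(i := tp l (rev ls @ r))" "2 * length ls + 3 \<le> t"
  shows "exec (goleft i P) c c' t"
proof -
  let ?L = "aact (hd0 r, MoveLeft) (tp (ls @ l) r)"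
  let ?R = "aact (hd0 (rev ls @ r), MoveLeft) (tp l (rev ls @ r))"
  have 1: "exec (move_head i MoveLeft) c (c(i := ?L)) 1"
    by (rule exec_move_head) (use assms in auto)
  have 2: "exec (whl (\<lambda>f. P (f i)) (move_head i MoveLeft)) (c(i := ?L)) (c(i := ?R)) (2 * length ls + 1)"
    by (rule exec_goleft_loop) (use assms in auto)
  have "aact (aread ?R, MoveRight) ?R = tp l (rev ls @ r)"
    using aact_right_left[of "tp l (rev ls @ r)"] by simp
  then have 3: "exec (move_head i MoveRight) (c(i := ?R)) c' 1"
    by (intro exec_move_head) (use assms in auto)
  show ?thesis
    unfolding goleft_def
    by (rule exec_seq[OF _ _ 1 exec_seq[OF _ _ 2 3 order_refl]])
       (use assms(6) in \<open>auto\<close>)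
qed

text \<open>Removes the superfluous zeros (symbol 1) of the number that ends left of the head.\<close>

definition strip :: "nat \<Rightarrow> turing_machine" where
  "strip i = move_head i MoveLeft ;; whl (\<lambda>f. f i = 1) (act [(i, \<lambda>f. (0, MoveLeft))]) ;; move_head i MoveRight"

lemma good_erase [simp]: "good (act [(i, \<lambda>f. (0, MoveLeft))])"
  by (rule good_act) auto

lemma good_strip [simp]: "good (strip i)"
  unfolding strip_def by (intro good_seq good_whl good_move_head good_erase)

lemma exec_strip_loop:
  assumes "i < 5" "hd0 l \<noteq> 1"
  shows "exec (whl (\<lambda>f. f i = 1) (act [(i, \<lambda>f. (0, MoveLeft))]))
     (c(i := aact (0, MoveLeft) (tp (replicate n 1 @ l) [])))
     (c(i := aact (0, MoveLeft) (tp l []))) (2 * n + 1)"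
proof (induction n)
  case 0
  let ?c = "c(i := aact (0, MoveLeft) (tp l []))"
  have "scanned ?c i \<noteq> 1"
    using assms by (simp add: scanned_lt aread_left del: aread_tp_hd0)
  from exec_whl_False[where b = "\<lambda>f. f i = 1" and M = "act [(i, \<lambda>f. (0, MoveLeft))]", OF this]
  show ?case by (simp only: replicate_0 append_Nil mult_0_right add_0_left)
next
  case (Suc n)
  let ?c = "c(i := aact (0, MoveLeft) (tp (replicate n 1 @ l) []))"
  have eq: "aact (0, MoveLeft) (tp (replicate (Suc n) 1 @ l) []) = tp (replicate n 1 @ l) [1]"
    by simp
  have 1: "exec (act [(i, \<lambda>f. (0, MoveLeft))]) (c(i := tp (replicate n 1 @ l) [1])) ?c 1"
    by (rule exec_act) (use assms(1) in \<open>auto simp: left_erase simp del: aact_tp\<close>)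
  show ?case
    unfolding eq
    by (rule exec_whl_True[OF good_erase _ 1 Suc]) (use assms(1) in \<open>auto simp: scanned_lt\<close>)
qed

text \<open>The number 0 is the empty word, so stripping it runs back to \<open>l\<close>; the
  condition \<open>hd0 l \<noteq> 1\<close> keeps the loop from erasing what stands there. For any
  other number the highest bit, symbol 2, stops the loop (\<open>last_bits\<close>).\<close>

lemma exec_strip:
  assumes "i < 5" "hd0 l \<noteq> 1" "set xs \<subseteq> {1, 2}"
    "c i = tp (rev xs @ l) []" "c' = c(i := tp (rev (bits (bits_value xs)) @ l) [])" "2 * length xs + 3 \<le> t"
  shows "exec (strip i) c c' t"
proof -
  obtain n where n: "xs = bits (bits_value xs) @ replicate n 1" using bits_bits_value assms(3) by blast
  let ?l = "rev (bits (bits_value xs)) @ l"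
  have l: "rev xs @ l = replicate n 1 @ ?l"
    by (subst n) simp
  have "length xs = length (bits (bits_value xs)) + n" by (subst n) simp
  then have len: "n \<le> length xs" by simp
  have hd: "hd0 ?l \<noteq> 1"
  proof (cases "bits_value xs = 0")
    case False
    then have "bits (bits_value xs) \<noteq> []" by (simp add: bits.simps[of "bits_value xs"])
    then obtain b bs where "bits (bits_value xs) = bs @ [b]" by (cases "bits (bits_value xs)" rule: rev_cases) auto
    then show ?thesis using last_bits[of "bits_value xs"] False by simp
  qed (use assms in simp)
  let ?L = "aact (0, MoveLeft) (tp (replicate n 1 @ ?l) [])"
  let ?R = "aact (0, MoveLeft) (tp ?l [])"
  have 1: "exec (move_head i MoveLeft) c (c(i := ?L)) 1"
    by (rule exec_move_head) (use assms l in auto)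
  have 2: "exec (whl (\<lambda>f. f i = 1) (act [(i, \<lambda>f. (0, MoveLeft))])) (c(i := ?L)) (c(i := ?R))
     (2 * n + 1)"
    by (rule exec_strip_loop) (use assms hd in auto)
  have "aact (aread ?R, MoveRight) ?R = tp ?l []"
    using aact_right_left[of "tp ?l []"] by simp
  then have 3: "exec (move_head i MoveRight) (c(i := ?R)) c' 1"
    by (intro exec_move_head) (use assms in auto)
  show ?thesis
    unfolding strip_def
    by (rule exec_seq[OF _ _ 1 exec_seq[OF _ _ 2 3 order_refl]])
       (use assms(6) len in \<open>auto\<close>)
qed

definition copy :: "nat \<Rightarrow> turing_machine" where
  "copy j = whl (\<lambda>f. f 0 \<noteq> 3) (act [(0, \<lambda>f. (f 0, MoveRight)), (j, \<lambda>f. (f 0, MoveRight))])"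

lemma good_copy [simp]: "good (copy j)"
  unfolding copy_def by (intro good_whl good_act) auto

lemma exec_copy:
  assumes "j < 5" "j \<noteq> 0" "3 \<notin> set xs" "c 0 = tp l (xs @ 3 # r)" "c j = tp l' []"
    "c' = c(0 := tp (rev xs @ l) (3 # r), j := tp (rev xs @ l') [])" "2 * length xs < t"
  shows "exec (copy j) c c' t"
  using assms(3-)
proof (induction xs arbitrary: c l l' t)
  case Nil
  have "exec (copy j) c c 1"
    unfolding copy_def by (rule exec_whl_False) (use Nil in simp)
  moreover have "c' = c" using Nil assms(2) by (auto simp: fun_eq_iff)
  ultimately show ?case using exec_mono Nil by auto
next
  case (Cons a xs)
  let ?c = "c(0 := tp (a # l) (xs @ 3 # r), j := tp (a # l') [])"
  let ?M = "act [(0, \<lambda>f. (f 0, MoveRight)), (j, \<lambda>f. (f 0, MoveRight))]"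
  have g: "good ?M" by (rule good_act) auto
  have 1: "exec ?M c ?c 1"
    by (rule exec_act) (use assms(1,2) Cons.prems in \<open>auto simp: fun_upd_twist\<close>)
  have 2: "exec (copy j) ?c c' (2 * length xs + 1)"
    by (rule Cons.IH) (use assms(2) Cons.prems in \<open>auto simp: fun_upd_twist\<close>)
  show ?case
    unfolding copy_def
    by (rule exec_whl_True[OF g _ 1 2[unfolded copy_def]]) (use Cons.prems in auto)
qed

text \<open>The subtrahend on tape 2 is overwritten while it is read. If the minuend is a birthday
  (\<open>i = 0\<close>), it takes the place of the subtrahend, as the next difference needs it. If
  it is the start time (\<open>i = 1\<close>), the chain ends and tape 2 is blanked.\<close>

definition sub_digits :: "nat \<Rightarrow> turing_machine" where
  "sub_digits i = whl (\<lambda>f. f i \<noteq> 3) (act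
     [(i, \<lambda>f. (f i, MoveRight)),
      (2, \<lambda>f. (if i = 0 then f 0 else 0, MoveRight)),
      (3, \<lambda>f. (if digit (f i) < digit (f 2) + f 3 then 1 else 0, Stay)),
      (4, \<lambda>f. (Suc ((digit (f i) + digit (f 2) + f 3) mod 2), MoveRight))])"

lemma good_sub_digits [simp]: "good (sub_digits i)"
  unfolding sub_digits_def by (intro good_whl good_act) auto

text \<open>The condition \<open>length ys \<le> length xs\<close> makes the pass over the minuend
  long enough to overwrite all of the old subtrahend.\<close>

lemma exec_sub_digits:
  assumes "i = 0 \<or> i = 1" "3 \<notin> set xs" "length ys \<le> length xs"
    "c i = tp l (xs @ 3 # r)" "c 2 = tp l2 ys" "c 3 = tp [] [b]" "c 4 = tp out []"
    "2 * length xs < t"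
  shows "\<exists>b' c'. exec (sub_digits i) c c' t \<and>
     c' = c(i := tp (rev xs @ l) (3 # r),
        2 := tp (rev (if i = 0 then xs else replicate (length xs) 0) @ l2) [],
        3 := tp [] [b'], 4 := tp (rev (sub_list xs ys b) @ out) [])"
  using assms(2-)
proof (induction xs arbitrary: c l l2 ys b out t)
  case Nil
  have "exec (sub_digits i) c c 1"
    unfolding sub_digits_def by (rule exec_whl_False) (use Nil assms(1) in auto)
  then have "exec (sub_digits i) c c t"
    using Nil.prems(7) exec_mono by auto
  then show ?case
    using Nil by (intro exI[of _ b] exI[of _ c]) (auto simp: fun_eq_iff)
next
  case (Cons a xs)
  let ?y = "if i = 0 then a else 0"
  let ?b = "if digit a < digit (hd0 ys) + b then 1 else 0 :: nat"
  let ?o = "Suc ((digit a + digit (hd0 ys) + b) mod 2)"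
  let ?c = "c(i := tp (a # l) (xs @ 3 # r), 2 := tp (?y # l2) (tl ys), 3 := tp [] [?b],
       4 := tp (?o # out) [])"
  let ?M = "act
     [(i, \<lambda>f. (f i, MoveRight)),
      (2, \<lambda>f. (if i = 0 then f 0 else 0, MoveRight)),
      (3, \<lambda>f. (if digit (f i) < digit (f 2) + f 3 then 1 else 0, Stay)),
      (4, \<lambda>f. (Suc ((digit (f i) + digit (f 2) + f 3) mod 2), MoveRight))]"
  have g: "good ?M" by (intro good_act) auto
  have step: "exec ?M c ?c 1"
    by (rule exec_act)
       (use assms(1) Cons.prems in \<open>cases ys; auto simp: fun_upd_twist fun_eq_iff\<close>)+
  define c1 where "c1 = ?c"
  have p: "3 \<notin> set xs" "length (tl ys) \<le> length xs" "c1 i = tp (a # l) (xs @ 3 # r)"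
    "c1 2 = tp (?y # l2) (tl ys)" "c1 3 = tp [] [?b]" "c1 4 = tp (?o # out) []"
    "2 * length xs < 2 * length xs + 1"
    using assms(1) Cons.prems by (auto simp: c1_def)
  obtain b' c' where 2: "exec (sub_digits i) c1 c' (2 * length xs + 1)" and
    c': "c' = c1(i := tp (rev xs @ a # l) (3 # r),
        2 := tp (rev (if i = 0 then xs else replicate (length xs) 0) @ ?y # l2) [],
        3 := tp [] [b'], 4 := tp (rev (sub_list xs (tl ys) ?b) @ ?o # out) [])"
    using Cons.IH[OF p] by blast
  note 2 = 2[unfolded c1_def] and c' = c'[unfolded c1_def]
  have "exec (sub_digits i) c c' t"
    unfolding sub_digits_def
    by (rule exec_whl_True[OF g _ step 2[unfolded sub_digits_def]])
       (use assms(1) Cons.prems in auto)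
  moreover have "c' = c(i := tp (rev (a # xs) @ l) (3 # r),
        2 := tp (rev (if i = 0 then a # xs else replicate (length (a # xs)) 0) @ l2) [],
        3 := tp [] [b'], 4 := tp (rev (sub_list (a # xs) ys b) @ out) [])"
    unfolding c' using assms(1) by (auto simp: fun_eq_iff replicate_app_Cons_same)
  ultimately show ?case by blast
qed

end

section \<open>Preprocessing and postprocessing\<close>

definition enc_weight :: "nat \<Rightarrow> nat list" where
  "enc_weight v = enc_rat (of_nat v)"

lemma enc_weight_eq: "enc_weight v = bits v @ [3, 2, 3]"
  by (simp add: enc_weight_def enc_rat_of_nat)

lemma enc_nat_append: "enc_nat k @ x = bits k @ 3 # x"
  by (simp add: enc_nat_def)

lemma bits_symbolsD: "a \<in> set (bits k) \<Longrightarrow> a \<noteq> 0 \<and> a \<noteq> 3 \<and> a \<noteq> 4"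
  using bits_symbols[of k] by auto

lemma hd0_bits: "hd0 (bits k @ 3 # r) \<noteq> 4" "hd0 (bits k @ 3 # r) \<noteq> 0"
  using bits_symbols[of k] by (cases "bits k"; auto)+

text \<open>\<open>p\<close> and \<open>b\<close> are the two birthdays read most recently. At the
  end of the list \<open>b\<close> belongs to the last message, whose delivery sets the age to 0;
  its weight measures the distance from its predecessor's birthday \<open>p\<close> to the start
  time instead.\<close>

fun weights_from :: "nat \<Rightarrow> nat \<Rightarrow> nat \<Rightarrow> nat list \<Rightarrow> nat list" where
  "weights_from T p b [] = [2 * (T - p) - 1]"
| "weights_from T p b (b' # bs) = 2 * (b - p) # weights_from T b b' bs"

context machine_combinators
begin

section \<open>Computing the weights\<close>

lemma exec_seqI:
  assumes "exec M1 c c1 t1" "exec M2 c1 c2 t2" "good M1" "good M2"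
  shows "exec (M1 ;; M2) c c2 (t1 + t2)"
  using exec_seq[OF assms(3,4,1,2)] by simp

text \<open>The symbol \<open>a\<close> is the low bit of the weight and \<open>b\<close> the
  initial borrow. An inner weight is \<open>2 * (x - y)\<close>: low bit 0, no borrow. The last one
  is \<open>2 * (x - y) - 1 = 1 + 2 * (x - y - 1)\<close>: low bit 1 and a borrow. The symbols 3, 2,
  3 complete the encoding as a rational with denominator 1.\<close>

definition emit_weight :: "nat \<Rightarrow> nat \<Rightarrow> nat \<Rightarrow> turing_machine" where
  "emit_weight a b i = act [(4, \<lambda>f. (if a = 2 then 2 else 1, MoveRight)),
       (3, \<lambda>f. (if b = 1 then 1 else 0, Stay))] ;;
     sub_digits i ;; strip 4 ;;
     act [(4, \<lambda>f. (3, MoveRight)), (3, \<lambda>f. (0, Stay))] ;;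
     act [(4, \<lambda>f. (2, MoveRight))] ;; act [(4, \<lambda>f. (3, MoveRight))]"

lemma good_emit_weight [simp]: "good (emit_weight a b i)"
  unfolding emit_weight_def by simp

lemma exec_emit_weight:
  assumes i: "i = 0 \<or> i = 1" and xs: "set xs \<subseteq> {1, 2}" and ys: "set ys \<subseteq> {1, 2}"
    and len: "length ys \<le> length xs" and le: "bits_value ys + b \<le> bits_value xs"
    and a: "a \<in> {1, 2}" and b: "b \<le> 1"
    and c: "c i = tp l (xs @ 3 # r)" "c 2 = tp l2 ys" "c 3 = tp [] []" "c 4 = tp out []"
    and out: "hd0 out \<noteq> 1" and t: "4 * length xs + 10 \<le> t"
    and c': "c' = c(i := tp (rev xs @ l) (3 # r),
        2 := tp (rev (if i = 0 then xs else replicate (length xs) 0) @ l2) [],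
        4 := tp (rev (enc_weight (a - 1 + 2 * (bits_value xs - bits_value ys - b))) @ out) [])"
  shows "exec (emit_weight a b i) c c' t"
proof -
  have ne: "i \<noteq> 2" "i \<noteq> 3" "i \<noteq> 4" using i by auto
  have b01: "b = 0 \<or> b = 1" using b by auto
  define c1 where "c1 = c(4 := tp (a # out) [], 3 := tp [] [b])"
  have 1: "exec (act [(4, \<lambda>f. (if a = 2 then 2 else 1, MoveRight)),
      (3, \<lambda>f. (if b = 1 then 1 else 0, Stay))]) c c1 1"
    by (rule exec_act) (use a b01 c in \<open>auto simp: c1_def fun_eq_iff\<close>)
  have p: "3 \<notin> set xs" "length ys \<le> length xs" "c1 i = tp l (xs @ 3 # r)" "c1 2 = tp l2 ys"
    "c1 3 = tp [] [b]" "c1 4 = tp (a # out) []" "2 * length xs < 2 * length xs + 1"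
    using xs len c ne by (auto simp: c1_def)
  obtain b' c2 where 2: "exec (sub_digits i) c1 c2 (2 * length xs + 1)" and
    c2: "c2 = c1(i := tp (rev xs @ l) (3 # r),
        2 := tp (rev (if i = 0 then xs else replicate (length xs) 0) @ l2) [],
        3 := tp [] [b'], 4 := tp (rev (sub_list xs ys b) @ a # out) [])"
    using exec_sub_digits[OF i p] by blast
  let ?ds = "a # sub_list xs ys b"
  have ds: "set ?ds \<subseteq> {1, 2}" using sub_list_symbols[of xs ys b] a by auto
  define c3 where "c3 = c2(4 := tp (rev (bits (bits_value ?ds)) @ out) [])"
  have 3: "exec (strip 4) c2 c3 (2 * length ?ds + 3)"
    by (rule exec_strip[OF _ out ds _ _ order_refl]) (auto simp: c2 c3_def)
  define c4 where "c4 = c3(4 := tp (3 # rev (bits (bits_value ?ds)) @ out) [], 3 := tp [] [])"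
  have 4: "exec (act [(4, \<lambda>f. (3, MoveRight)), (3, \<lambda>f. (0, Stay))]) c3 c4 1"
    by (rule exec_act) (auto simp: c4_def c3_def c2 fun_eq_iff)
  define c5 where "c5 = c4(4 := tp (2 # 3 # rev (bits (bits_value ?ds)) @ out) [])"
  have 5: "exec (act [(4, \<lambda>f. (2, MoveRight))]) c4 c5 1"
    by (rule exec_act) (auto simp: c5_def c4_def)
  have v: "bits_value (sub_list xs ys b) = bits_value xs - bits_value ys - b"
    using val_sub_list[OF xs ys b le] by simp
  have 6: "exec (act [(4, \<lambda>f. (3, MoveRight))]) c5 c' 1"
    by (rule exec_act)
       (use ne in \<open>auto simp: c5_def c4_def c3_def c2 c1_def c' c v enc_weight_eq fun_eq_iff\<close>)
  show ?thesis
    unfolding emit_weight_def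
    by (rule exec_mono[OF exec_seqI[OF 1 exec_seqI[OF 2 exec_seqI[OF 3 exec_seqI[OF 4 exec_seqI[OF 5 6]]]]]])
       (use t in simp_all)
qed

text \<open>
  Whether a message is the last one of its chain is only known after its birthday has been read.
  Therefore \<open>msg_step\<close> and \<open>msg_loop\<close> start behind a birthday; a step moves back over it,
  writes its weight, and advances behind the next one.
\<close>

definition msg_step :: turing_machine where
  "msg_step = move_head 0 MoveLeft ;; goleft 0 (\<lambda>a. a \<noteq> 3) ;; emit_weight 1 0 0 ;; goleft 2 (\<lambda>a. a \<noteq> 0) ;;
     move_head 0 MoveRight ;; goright 0 (\<lambda>a. a \<noteq> 3) ;; move_head 0 MoveRight"

lemma good_msg_step [simp]: "good msg_step"
  unfolding msg_step_def by simp

lemma exec_msg_step: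
  assumes "p < b" "length (bits b) \<le> N" "length (bits b') \<le> N" "hd0 out \<noteq> 1"
  shows "exec msg_step
    (cfg (tp (3 # rev (bits b) @ 3 # l) (bits b' @ 3 # r)) t1 (tp [] (bits p)) (tp [] []) (tp out []) R)
    (cfg (tp (3 # rev (bits b') @ 3 # rev (bits b) @ 3 # l) r) t1 (tp [] (bits b)) (tp [] [])
      (tp (rev (enc_weight (2 * (b - p))) @ out) []) R) (10 * N + 20)"
proof -
  let ?r1 = "bits b' @ 3 # r"
  have 1: "exec (move_head 0 MoveLeft)
    (cfg (tp (3 # rev (bits b) @ 3 # l) ?r1) t1 (tp [] (bits p)) (tp [] []) (tp out []) R)
    (cfg (tp (rev (bits b) @ 3 # l) (3 # ?r1)) t1 (tp [] (bits p)) (tp [] []) (tp out []) R) 1"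
    by (rule exec_move_head) (use left_Cons[of 3 "rev (bits b) @ 3 # l" ?r1] in auto)
  have 2: "exec (goleft 0 (\<lambda>a. a \<noteq> 3))
    (cfg (tp (rev (bits b) @ 3 # l) (3 # ?r1)) t1 (tp [] (bits p)) (tp [] []) (tp out []) R)
    (cfg (tp (3 # l) (bits b @ 3 # ?r1)) t1 (tp [] (bits p)) (tp [] []) (tp out []) R) (2 * N + 3)"
    by (rule exec_goleft[where ls = "rev (bits b)" and l = "3 # l" and r = "3 # ?r1"])
       (use assms in \<open>auto dest: bits_symbolsD\<close>)
  have 3: "exec (emit_weight 1 0 0)
    (cfg (tp (3 # l) (bits b @ 3 # ?r1)) t1 (tp [] (bits p)) (tp [] []) (tp out []) R)
    (cfg (tp (rev (bits b) @ 3 # l) (3 # ?r1)) t1 (tp (rev (bits b)) []) (tp [] [])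
      (tp (rev (enc_weight (2 * (b - p))) @ out) []) R) (4 * N + 10)"
    by (rule exec_emit_weight[where xs = "bits b" and ys = "bits p" and l = "3 # l" and r = ?r1 and
          ?l2.0 = "[]" and out = out])
       (use assms bits_symbols length_bits_mono[of p b] in auto)
  have 4: "exec (goleft 2 (\<lambda>a. a \<noteq> 0))
    (cfg (tp (rev (bits b) @ 3 # l) (3 # ?r1)) t1 (tp (rev (bits b)) []) (tp [] [])
      (tp (rev (enc_weight (2 * (b - p))) @ out) []) R)
    (cfg (tp (rev (bits b) @ 3 # l) (3 # ?r1)) t1 (tp [] (bits b)) (tp [] [])
      (tp (rev (enc_weight (2 * (b - p))) @ out) []) R) (2 * N + 3)"
    by (rule exec_goleft[where ls = "rev (bits b)" and l = "[]" and r = "[]"])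
       (use assms in \<open>auto dest: bits_symbolsD\<close>)
  have 5: "exec (move_head 0 MoveRight)
    (cfg (tp (rev (bits b) @ 3 # l) (3 # ?r1)) t1 (tp [] (bits b)) (tp [] [])
      (tp (rev (enc_weight (2 * (b - p))) @ out) []) R)
    (cfg (tp (3 # rev (bits b) @ 3 # l) ?r1) t1 (tp [] (bits b)) (tp [] [])
      (tp (rev (enc_weight (2 * (b - p))) @ out) []) R) 1"
    by (rule exec_move_head) auto
  have 6: "exec (goright 0 (\<lambda>a. a \<noteq> 3))
    (cfg (tp (3 # rev (bits b) @ 3 # l) ?r1) t1 (tp [] (bits b)) (tp [] [])
      (tp (rev (enc_weight (2 * (b - p))) @ out) []) R)
    (cfg (tp (rev (bits b') @ 3 # rev (bits b) @ 3 # l) (3 # r)) t1 (tp [] (bits b)) (tp [] [])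
      (tp (rev (enc_weight (2 * (b - p))) @ out) []) R) (2 * N + 1)"
    by (rule exec_goright[where xs = "bits b'" and r = "3 # r"]) (use assms in \<open>auto dest: bits_symbolsD\<close>)
  have 7: "exec (move_head 0 MoveRight)
    (cfg (tp (rev (bits b') @ 3 # rev (bits b) @ 3 # l) (3 # r)) t1 (tp [] (bits b)) (tp [] [])
      (tp (rev (enc_weight (2 * (b - p))) @ out) []) R)
    (cfg (tp (3 # rev (bits b') @ 3 # rev (bits b) @ 3 # l) r) t1 (tp [] (bits b)) (tp [] [])
      (tp (rev (enc_weight (2 * (b - p))) @ out) []) R) 1"
    by (rule exec_move_head) auto
  show ?thesis
    unfolding msg_step_def
    by (rule exec_mono[OF exec_seqI[OF 1 exec_seqI[OF 2 exec_seqI[OF 3 exec_seqI[OF 4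
          exec_seqI[OF 5 exec_seqI[OF 6 7]]]]]]]) simp_all
qed

definition msg_loop :: turing_machine where
  "msg_loop = whl (\<lambda>f. f 0 \<noteq> 4) msg_step"

lemma good_msg_loop [simp]: "good msg_loop"
  unfolding msg_loop_def by simp

text \<open>When the loop stops, the last message has been passed but its weight is still missing;
  the final equation accounts for it. \<open>p'\<close> is the birthday before the last one, hence
  \<open>p' < T\<close>, so the missing weight is positive.\<close>

lemma exec_msg_loop:
  assumes "sorted_wrt (<) (p # b # bs)" "\<forall>x \<in> set (p # b # bs). x \<le> T" "hd0 out \<noteq> 1"
  shows "\<exists>l' p' out'. exec msg_loop
    (cfg (tp (3 # rev (bits b) @ 3 # l) (concat (map enc_nat bs) @ 4 # r)) t1 (tp [] (bits p))
      (tp [] []) (tp out []) R)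
    (cfg (tp l' (4 # r)) t1 (tp [] (bits p')) (tp [] []) (tp out' []) R)
    (length bs * (10 * length (bits T) + 21) + 1) \<and> p' < T \<and> hd0 out' \<noteq> 1 \<and>
    rev (enc_weight (2 * (T - p') - 1)) @ out' = rev (concat (map enc_weight (weights_from T p b bs))) @ out"
  using assms
proof (induction bs arbitrary: p b l out)
  case Nil
  let ?l = "3 # rev (bits b) @ 3 # l"
  have "exec msg_loop (cfg (tp ?l (4 # r)) t1 (tp [] (bits p)) (tp [] []) (tp out []) R)
      (cfg (tp ?l (4 # r)) t1 (tp [] (bits p)) (tp [] []) (tp out []) R) 1"
    unfolding msg_loop_def by (rule exec_whl_False) simp
  then show ?case
    using Nil by - (rule exI[of _ ?l], rule exI[of _ p], rule exI[of _ out], auto)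
next
  case (Cons b' bs)
  let ?N = "length (bits T)"
  let ?o = "rev (enc_weight (2 * (b - p))) @ out"
  have 1: "exec msg_step
    (cfg (tp (3 # rev (bits b) @ 3 # l) (bits b' @ 3 # concat (map enc_nat bs) @ 4 # r)) t1
      (tp [] (bits p)) (tp [] []) (tp out []) R)
    (cfg (tp (3 # rev (bits b') @ 3 # rev (bits b) @ 3 # l) (concat (map enc_nat bs) @ 4 # r)) t1
      (tp [] (bits b)) (tp [] []) (tp ?o []) R) (10 * ?N + 20)"
    by (rule exec_msg_step) (use Cons.prems length_bits_mono in auto)
  have IH_prems: "sorted_wrt (<) (b # b' # bs)" "\<forall>x \<in> set (b # b' # bs). x \<le> T" "hd0 ?o \<noteq> 1"
    using Cons.prems by (simp_all add: enc_weight_eq)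
  obtain l' p' out' where 2: "exec msg_loop
    (cfg (tp (3 # rev (bits b') @ 3 # rev (bits b) @ 3 # l) (concat (map enc_nat bs) @ 4 # r)) t1
      (tp [] (bits b)) (tp [] []) (tp ?o []) R)
    (cfg (tp l' (4 # r)) t1 (tp [] (bits p')) (tp [] []) (tp out' []) R)
    (length bs * (10 * ?N + 21) + 1)"
    and props: "p' < T" "hd0 out' \<noteq> 1"
    "rev (enc_weight (2 * (T - p') - 1)) @ out' = rev (concat (map enc_weight (weights_from T b b' bs))) @ ?o"
    using Cons.IH[where l = "rev (bits b) @ 3 # l", OF IH_prems] by blast
  have "exec msg_loop
    (cfg (tp (3 # rev (bits b) @ 3 # l) (bits b' @ 3 # concat (map enc_nat bs) @ 4 # r)) t1
      (tp [] (bits p)) (tp [] []) (tp out []) R)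
    (cfg (tp l' (4 # r)) t1 (tp [] (bits p')) (tp [] []) (tp out' []) R)
    (length (b' # bs) * (10 * ?N + 21) + 1)"
    unfolding msg_loop_def
    by (rule exec_whl_True[OF good_msg_step _ 1 2[unfolded msg_loop_def]])
       (use hd0_bits in auto)
  with props show ?case
    by - (rule exI[of _ l'], rule exI[of _ p'], rule exI[of _ out'], simp add: enc_nat_append)
qed

text \<open>The first two birthdays establish the state that \<open>msg_loop\<close> expects: the
  first one is copied to tape 2, and the head on tape 0 moves behind the second one. A receiver
  always has both, as it has at least one message besides message 0.\<close>

definition chain_step :: turing_machine where
  "chain_step = copy 2 ;; goleft 2 (\<lambda>a. a \<noteq> 0) ;; move_head 0 MoveRight ;; goright 0 (\<lambda>a. a \<noteq> 3) ;;
     move_head 0 MoveRight ;; msg_loop ;; emit_weight 2 1 1 ;; goleft 1 (\<lambda>a. a \<noteq> 0) ;;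
     act [(0, \<lambda>f. (f 0, MoveRight)), (4, \<lambda>f. (4, MoveRight))]"

lemma good_chain_step [simp]: "good chain_step"
  unfolding chain_step_def by simp

lemma exec_chain_step:
  assumes "sorted_wrt (<) (p # b # bs)" "\<forall>x \<in> set (p # b # bs). x \<le> T" "hd0 out \<noteq> 1"
  shows "\<exists>l'. exec chain_step
    (cfg (tp l (enc_list enc_nat (p # b # bs) @ r)) (tp [] (bits T @ [3])) (tp [] [])
      (tp [] []) (tp out []) R)
    (cfg (tp l' r) (tp [] (bits T @ [3])) (tp [] [])
      (tp [] []) (tp (rev (enc_list enc_weight (weights_from T p b bs)) @ out) []) R)
    (length bs * (10 * length (bits T) + 21) + 12 * length (bits T) + 30)"
proof -
  let ?N = "length (bits T)"
  let ?t1 = "tp [] (bits T @ [3])"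
  let ?r2 = "concat (map enc_nat bs) @ 4 # r"
  let ?r1 = "bits b @ 3 # ?r2"
  have len: "length (bits p) \<le> ?N" "length (bits b) \<le> ?N"
    using assms length_bits_mono by auto
  have 1: "exec (copy 2)
    (cfg (tp l (bits p @ 3 # ?r1)) ?t1 (tp [] []) (tp [] []) (tp out []) R)
    (cfg (tp (rev (bits p) @ l) (3 # ?r1)) ?t1 (tp (rev (bits p)) []) (tp [] []) (tp out []) R)
    (2 * ?N + 1)"
    by (rule exec_copy[where xs = "bits p" and r = ?r1 and l' = "[]"]) (use len in auto)
  have 2: "exec (goleft 2 (\<lambda>a. a \<noteq> 0))
    (cfg (tp (rev (bits p) @ l) (3 # ?r1)) ?t1 (tp (rev (bits p)) []) (tp [] []) (tp out []) R)
    (cfg (tp (rev (bits p) @ l) (3 # ?r1)) ?t1 (tp [] (bits p)) (tp [] []) (tp out []) R)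
    (2 * ?N + 3)"
    by (rule exec_goleft[where ls = "rev (bits p)" and l = "[]" and r = "[]"])
       (use len in \<open>auto dest: bits_symbolsD\<close>)
  have 3: "exec (move_head 0 MoveRight)
    (cfg (tp (rev (bits p) @ l) (3 # ?r1)) ?t1 (tp [] (bits p)) (tp [] []) (tp out []) R)
    (cfg (tp (3 # rev (bits p) @ l) ?r1) ?t1 (tp [] (bits p)) (tp [] []) (tp out []) R) 1"
    by (rule exec_move_head) auto
  have 4: "exec (goright 0 (\<lambda>a. a \<noteq> 3))
    (cfg (tp (3 # rev (bits p) @ l) ?r1) ?t1 (tp [] (bits p)) (tp [] []) (tp out []) R)
    (cfg (tp (rev (bits b) @ 3 # rev (bits p) @ l) (3 # ?r2)) ?t1 (tp [] (bits p)) (tp [] [])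
      (tp out []) R) (2 * ?N + 1)"
    by (rule exec_goright[where xs = "bits b" and r = "3 # ?r2"]) (use len in \<open>auto dest: bits_symbolsD\<close>)
  have 5: "exec (move_head 0 MoveRight)
    (cfg (tp (rev (bits b) @ 3 # rev (bits p) @ l) (3 # ?r2)) ?t1 (tp [] (bits p)) (tp [] [])
      (tp out []) R)
    (cfg (tp (3 # rev (bits b) @ 3 # rev (bits p) @ l) ?r2) ?t1 (tp [] (bits p)) (tp [] [])
      (tp out []) R) 1"
    by (rule exec_move_head) auto
  obtain l' p' out' where 6: "exec msg_loop
    (cfg (tp (3 # rev (bits b) @ 3 # rev (bits p) @ l) ?r2) ?t1 (tp [] (bits p)) (tp [] [])
      (tp out []) R)
    (cfg (tp l' (4 # r)) ?t1 (tp [] (bits p')) (tp [] []) (tp out' []) R)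
    (length bs * (10 * ?N + 21) + 1)"
    and props: "p' < T" "hd0 out' \<noteq> 1"
    "rev (enc_weight (2 * (T - p') - 1)) @ out' = rev (concat (map enc_weight (weights_from T p b bs))) @ out"
    using exec_msg_loop[OF assms] by blast
  let ?o = "rev (enc_weight (2 * (T - p') - 1)) @ out'"
  \<comment> \<open>The shape in which \<open>emit_weight 2 1 1\<close> produces this weight: low
    bit 1, and above it a difference with a borrow.\<close>
  have w: "2 * (T - p') - 1 = Suc (2 * (T - Suc p'))" using props(1) by simp
  \<comment> \<open>Subtracting from the start time leaves tape 2 full of blanks. By
    \<open>tp_zeros\<close> this is the empty tape that the next chain requires.\<close>
  have 7: "exec (emit_weight 2 1 1)
    (cfg (tp l' (4 # r)) ?t1 (tp [] (bits p')) (tp [] []) (tp out' []) R)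
    (cfg (tp l' (4 # r)) (tp (rev (bits T)) [3]) (tp [] []) (tp [] []) (tp ?o []) R) (4 * ?N + 10)"
    by (rule exec_emit_weight[where xs = "bits T" and ys = "bits p'" and l = "[]" and r = "[]" and
          ?l2.0 = "[]" and out = out'])
       (use props bits_symbols length_bits_mono[of p' T] tp_zeros w in auto)
  have 8: "exec (goleft 1 (\<lambda>a. a \<noteq> 0))
    (cfg (tp l' (4 # r)) (tp (rev (bits T)) [3]) (tp [] []) (tp [] []) (tp ?o []) R)
    (cfg (tp l' (4 # r)) ?t1 (tp [] []) (tp [] []) (tp ?o []) R) (2 * ?N + 3)"
    by (rule exec_goleft[where ls = "rev (bits T)" and l = "[]" and r = "[3]"])
       (auto dest: bits_symbolsD)
  have 9: "exec (act [(0, \<lambda>f. (f 0, MoveRight)), (4, \<lambda>f. (4, MoveRight))])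
    (cfg (tp l' (4 # r)) ?t1 (tp [] []) (tp [] []) (tp ?o []) R)
    (cfg (tp (4 # l') r) ?t1 (tp [] []) (tp [] [])
      (tp (rev (enc_list enc_weight (weights_from T p b bs)) @ out) []) R) 1"
    by (rule exec_act) (simp_all add: enc_list_def props(3)[unfolded One_nat_def, symmetric])
  have "exec chain_step
    (cfg (tp l (bits p @ 3 # ?r1)) ?t1 (tp [] []) (tp [] []) (tp out []) R)
    (cfg (tp (4 # l') r) ?t1 (tp [] []) (tp [] [])
      (tp (rev (enc_list enc_weight (weights_from T p b bs)) @ out) []) R)
    (length bs * (10 * ?N + 21) + 12 * ?N + 30)"
    unfolding chain_step_def
    by (rule exec_mono[OF exec_seqI[OF 1 exec_seqI[OF 2 exec_seqI[OF 3 exec_seqI[OF 4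
          exec_seqI[OF 5 exec_seqI[OF 6 exec_seqI[OF 7 exec_seqI[OF 8 9]]]]]]]]])
       simp_all
  then show ?thesis
    by (intro exI[of _ "4 # l'"]) (simp add: enc_list_def enc_nat_append)
qed

end

fun chain_weights :: "nat \<Rightarrow> nat list \<Rightarrow> nat list" where
  "chain_weights T (p # b # bs) = weights_from T p b bs"
| "chain_weights T _ = []"

definition valid_chain :: "nat \<Rightarrow> nat list \<Rightarrow> bool" where
  "valid_chain T zs \<longleftrightarrow> 2 \<le> length zs \<and> sorted_wrt (<) zs \<and> (\<forall>x \<in> set zs. x \<le> T)"

lemma valid_chainE:
  assumes "valid_chain T zs"
  obtains p b bs where "zs = p # b # bs" "sorted_wrt (<) (p # b # bs)" "\<forall>x \<in> set (p # b # bs). x \<le> T"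
  using assms by (cases zs; cases "tl zs") (auto simp: valid_chain_def)

lemma hd0_enc_list_nat: "zs \<noteq> [] \<Longrightarrow> hd0 (enc_list enc_nat zs @ r) \<noteq> 4"
  using hd0_bits by (cases zs) (auto simp: enc_list_def enc_nat_append)

lemma hd0_rev_enc_list: "hd0 (rev (enc_list f xs) @ r) = 4"
  by (simp add: enc_list_def)

lemma zero_notin_enc: "0 \<notin> set (enc_list (enc_list enc_weight) wss)"
  by (auto simp: enc_list_def enc_weight_eq)

context machine_combinators
begin

definition chain_loop :: turing_machine where
  "chain_loop = whl (\<lambda>f. f 0 \<noteq> 4) chain_step"

lemma good_chain_loop [simp]: "good chain_loop"
  unfolding chain_loop_def by simp

lemma exec_chain_loop:
  assumes "\<forall>zs \<in> set css. valid_chain T zs \<and> length zs \<le> m" "hd0 out \<noteq> 1"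
  shows "\<exists>l'. exec chain_loop
    (cfg (tp l (concat (map (enc_list enc_nat) css) @ 4 # r)) (tp [] (bits T @ [3])) (tp [] [])
      (tp [] []) (tp out []) R)
    (cfg (tp l' (4 # r)) (tp [] (bits T @ [3])) (tp [] []) (tp [] [])
      (tp (rev (concat (map (\<lambda>zs. enc_list enc_weight (chain_weights T zs)) css)) @ out) []) R)
    (length css * (m * (10 * length (bits T) + 21) + 12 * length (bits T) + 31) + 1)"
  using assms
proof (induction css arbitrary: l out)
  case Nil
  let ?c = "cfg (tp l (4 # r)) (tp [] (bits T @ [3])) (tp [] []) (tp [] []) (tp out []) R"
  have "exec chain_loop ?c ?c 1"
    unfolding chain_loop_def by (rule exec_whl_False) simp
  then show ?case by (intro exI[of _ l]) simp
next
  case (Cons zs css)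
  let ?N = "length (bits T)"
  let ?t1 = "tp [] (bits T @ [3])"
  let ?B = "m * (10 * ?N + 21) + 12 * ?N + 30"
  let ?r = "concat (map (enc_list enc_nat) css) @ 4 # r"
  let ?o = "rev (enc_list enc_weight (chain_weights T zs)) @ out"
  obtain p b bs where zs: "zs = p # b # bs" and v: "sorted_wrt (<) (p # b # bs)"
    "\<forall>x \<in> set (p # b # bs). x \<le> T"
    using Cons.prems valid_chainE by (metis list.set_intros(1))
  have "length bs \<le> m" using Cons.prems zs by auto
  then have le: "length bs * (10 * ?N + 21) + 12 * ?N + 30 \<le> ?B"
    by (simp add: mult_le_mono1)
  obtain l1 where "exec chain_step
    (cfg (tp l (enc_list enc_nat zs @ ?r)) ?t1 (tp [] []) (tp [] []) (tp out []) R)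
    (cfg (tp l1 ?r) ?t1 (tp [] []) (tp [] []) (tp ?o []) R)
    (length bs * (10 * ?N + 21) + 12 * ?N + 30)"
    using exec_chain_step[OF v Cons.prems(2)] unfolding zs chain_weights.simps by blast
  note 1 = exec_mono[OF this le]
  have IH_prems: "\<forall>zs \<in> set css. valid_chain T zs \<and> length zs \<le> m" "hd0 ?o \<noteq> 1"
    using Cons.prems by (simp_all add: hd0_rev_enc_list)
  obtain l' where 2: "exec chain_loop
    (cfg (tp l1 ?r) ?t1 (tp [] []) (tp [] []) (tp ?o []) R)
    (cfg (tp l' (4 # r)) ?t1 (tp [] []) (tp [] [])
      (tp (rev (concat (map (\<lambda>zs. enc_list enc_weight (chain_weights T zs)) css)) @ ?o) []) R)
    (length css * (m * (10 * ?N + 21) + 12 * ?N + 31) + 1)"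
    using Cons.IH[OF IH_prems] by blast
  have "exec chain_loop
    (cfg (tp l (enc_list enc_nat zs @ ?r)) ?t1 (tp [] []) (tp [] []) (tp out []) R)
    (cfg (tp l' (4 # r)) ?t1 (tp [] []) (tp [] [])
      (tp (rev (concat (map (\<lambda>zs. enc_list enc_weight (chain_weights T zs)) css)) @ ?o) []) R)
    (length (zs # css) * (m * (10 * ?N + 21) + 12 * ?N + 31) + 1)"
    unfolding chain_loop_def
    by (rule exec_whl_True[OF good_chain_step _ 1 2[unfolded chain_loop_def]])
       (use hd0_enc_list_nat[of zs] in \<open>simp_all add: zs\<close>)
  then show ?case by (intro exI[of _ l']) simp
qed

definition preprocess :: turing_machine where
  "preprocess = copy 1 ;; act [(1, \<lambda>f. (3, MoveRight))] ;; goleft 1 (\<lambda>a. a \<noteq> 0) ;; move_head 0 MoveRight ;;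
     chain_loop ;; act [(4, \<lambda>f. (4, MoveRight))] ;; goleft 4 (\<lambda>a. a \<noteq> 0)"

lemma good_preprocess [simp]: "good preprocess"
  unfolding preprocess_def by simp

abbreviation blank :: atape where
  "blank \<equiv> tp [] []"

lemma start_conf_cfg: "start_conf x = cfg (tp [] x) blank blank blank blank (\<lambda>_. blank)"
  by (auto simp: start_conf_def cfg_def fun_eq_iff)

lemma exec_preprocess:
  assumes "\<forall>zs \<in> set css. valid_chain T zs \<and> length zs \<le> m"
    and x: "x = enc_nat T @ enc_list (enc_list enc_nat) css"
    and x': "x' = enc_list (enc_list enc_weight) (map (chain_weights T) css)"
  shows "\<exists>l'. exec preprocess (start_conf x)
    (cfg (tp l' [4]) (tp [] (bits T @ [3])) blank blank (tp [] x') (\<lambda>_. blank))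
    (length css * (m * (10 * length (bits T) + 21) + 12 * length (bits T) + 31)
      + 4 * length (bits T) + 2 * length x' + 20)"
proof -
  let ?N = "length (bits T)"
  let ?R = "\<lambda>_. blank"
  let ?r = "concat (map (enc_list enc_nat) css) @ [4]"
  let ?t1 = "tp [] (bits T @ [3])"
  have 1: "exec (copy 1) (cfg (tp [] (bits T @ 3 # ?r)) blank blank blank blank ?R)
    (cfg (tp (rev (bits T)) (3 # ?r)) (tp (rev (bits T)) []) blank blank blank ?R) (2 * ?N + 1)"
    by (rule exec_copy[where xs = "bits T" and r = ?r and l' = "[]" and l = "[]"]) auto
  have 2: "exec (act [(1, \<lambda>f. (3, MoveRight))])
    (cfg (tp (rev (bits T)) (3 # ?r)) (tp (rev (bits T)) []) blank blank blank ?R)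
    (cfg (tp (rev (bits T)) (3 # ?r)) (tp (3 # rev (bits T)) []) blank blank blank ?R) 1"
    by (rule exec_act) auto
  have 3: "exec (goleft 1 (\<lambda>a. a \<noteq> 0))
    (cfg (tp (rev (bits T)) (3 # ?r)) (tp (3 # rev (bits T)) []) blank blank blank ?R)
    (cfg (tp (rev (bits T)) (3 # ?r)) ?t1 blank blank blank ?R) (2 * ?N + 5)"
    by (rule exec_goleft[where ls = "3 # rev (bits T)" and l = "[]" and r = "[]"])
       (auto dest: bits_symbolsD)
  have 4: "exec (move_head 0 MoveRight)
    (cfg (tp (rev (bits T)) (3 # ?r)) ?t1 blank blank blank ?R)
    (cfg (tp (3 # rev (bits T)) ?r) ?t1 blank blank blank ?R) 1"
    by (rule exec_move_head) auto
  have "hd0 [] \<noteq> 1" by simp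
  from exec_chain_loop[OF assms(1) this] obtain l' where 5: "exec chain_loop
    (cfg (tp (3 # rev (bits T)) ?r) ?t1 blank blank blank ?R)
    (cfg (tp l' [4]) ?t1 blank blank
      (tp (rev (concat (map (\<lambda>zs. enc_list enc_weight (chain_weights T zs)) css)) @ []) []) ?R)
    (length css * (m * (10 * ?N + 21) + 12 * ?N + 31) + 1)"
    by blast
  have x'_eq: "x' = concat (map (\<lambda>zs. enc_list enc_weight (chain_weights T zs)) css) @ [4]"
    by (simp add: x' enc_list_def[of "enc_list enc_weight"] comp_def)
  have 6: "exec (act [(4, \<lambda>f. (4, MoveRight))])
    (cfg (tp l' [4]) ?t1 blank blank
      (tp (rev (concat (map (\<lambda>zs. enc_list enc_weight (chain_weights T zs)) css)) @ []) []) ?R)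
    (cfg (tp l' [4]) ?t1 blank blank (tp (rev x') []) ?R) 1"
    by (rule exec_act) (simp_all add: x'_eq)
  have "0 \<notin> set x'" unfolding x' by (rule zero_notin_enc)
  then have zero: "a \<in> set (rev x') \<Longrightarrow> a \<noteq> 0" for a by (metis set_rev)
  have 7: "exec (goleft 4 (\<lambda>a. a \<noteq> 0))
    (cfg (tp l' [4]) ?t1 blank blank (tp (rev x') []) ?R)
    (cfg (tp l' [4]) ?t1 blank blank (tp [] x') ?R) (2 * length x' + 3)"
    by (rule exec_goleft[where ls = "rev x'" and l = "[]" and r = "[]"])
       (use zero in simp_all)
  have "start_conf x = cfg (tp [] (bits T @ 3 # ?r)) blank blank blank blank ?R"
    by (simp add: start_conf_cfg x enc_nat_append enc_list_def[of "enc_list enc_nat"])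
  moreover have "exec preprocess (cfg (tp [] (bits T @ 3 # ?r)) blank blank blank blank ?R)
    (cfg (tp l' [4]) ?t1 blank blank (tp [] x') ?R)
    (length css * (m * (10 * ?N + 21) + 12 * ?N + 31) + 4 * ?N + 2 * length x' + 20)"
    unfolding preprocess_def
    by (rule exec_mono[OF exec_seqI[OF 1 exec_seqI[OF 2 exec_seqI[OF 3 exec_seqI[OF 4
          exec_seqI[OF 5 exec_seqI[OF 6 7]]]]]]]) simp_all
  ultimately show ?thesis by auto
qed

section \<open>Adding the start time to a schedule\<close>

definition add_digits :: turing_machine where
  "add_digits = whl (\<lambda>f. f 4 \<noteq> 3 \<or> f 1 \<noteq> 3) (act
     [(0, \<lambda>f. (Suc ((digit (f 4) + digit (f 1) + f 3) mod 2), MoveRight)),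
      (1, \<lambda>f. (f 1, if f 1 = 3 then Stay else MoveRight)),
      (3, \<lambda>f. (if 2 \<le> digit (f 4) + digit (f 1) + f 3 then 1 else 0, Stay)),
      (4, \<lambda>f. (f 4, if f 4 = 3 then Stay else MoveRight))])"

lemma good_add_digits [simp]: "good add_digits"
  unfolding add_digits_def by simp

text \<open>A head that reaches its separator waits there, and \<open>digit 3 = 0\<close> pads the
  shorter summand. The last digit of \<open>add_list\<close> is the carry; it remains on tape 3, and
  \<open>add_step\<close> writes it.\<close>

lemma exec_add_digits:
  assumes "3 \<notin> set xs" "3 \<notin> set ys" "b \<le> 1"
  shows "\<exists>ds b'. exec add_digits
    (cfg (tp out []) (tp l1 (ys @ 3 # r1)) t2 (tp [] [b]) (tp l (xs @ 3 # r)) R)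
    (cfg (tp (rev ds @ out) []) (tp (rev ys @ l1) (3 # r1)) t2 (tp [] [b'])
      (tp (rev xs @ l) (3 # r)) R)
    (2 * max (length xs) (length ys) + 1) \<and> b' \<le> 1 \<and> add_list xs ys b = ds @ [Suc b']"
  using assms
proof (induction xs ys b arbitrary: out l1 l rule: add_list.induct)
  case (1 xs ys b)
  show ?case
  proof (cases "xs = [] \<and> ys = []")
    case True
    have "exec add_digits
      (cfg (tp out []) (tp l1 (3 # r1)) t2 (tp [] [b]) (tp l (3 # r)) R)
      (cfg (tp out []) (tp l1 (3 # r1)) t2 (tp [] [b]) (tp l (3 # r)) R) 1"
      unfolding add_digits_def by (rule exec_whl_False) simp
    then show ?thesis
      using True "1.prems" by - (rule exI[of _ "[]"], rule exI[of _ b], simp add: add_list.simps)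
  next
    case False
    let ?d = "digit (hd0 xs) + digit (hd0 ys) + b"
    let ?o = "Suc (?d mod 2)"
    define b1 :: nat where "b1 = (if 2 \<le> ?d then 1 else 0)"
    define l1' where "l1' = (case ys of [] \<Rightarrow> l1 | y # _ \<Rightarrow> y # l1)"
    define l' where "l' = (case xs of [] \<Rightarrow> l | x # _ \<Rightarrow> x # l)"
    let ?M = "act
     [(0, \<lambda>f. (Suc ((digit (f 4) + digit (f 1) + f 3) mod 2), MoveRight)),
      (1, \<lambda>f. (f 1, if f 1 = 3 then Stay else MoveRight)),
      (3, \<lambda>f. (if 2 \<le> digit (f 4) + digit (f 1) + f 3 then 1 else 0, Stay)),
      (4, \<lambda>f. (f 4, if f 4 = 3 then Stay else MoveRight))]"
    have g: "good ?M" by simp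
    have 1: "exec ?M
      (cfg (tp out []) (tp l1 (ys @ 3 # r1)) t2 (tp [] [b]) (tp l (xs @ 3 # r)) R)
      (cfg (tp (?o # out) []) (tp l1' (tl ys @ 3 # r1)) t2 (tp [] [b1]) (tp l' (tl xs @ 3 # r)) R) 1"
      by (rule exec_act)
         (use "1.prems" in \<open>cases xs; cases ys; auto simp: l1'_def l'_def b1_def\<close>)+
    have prems: "3 \<notin> set (tl xs)" "3 \<notin> set (tl ys)" "b1 \<le> 1"
      using "1.prems" by (cases xs; cases ys; simp add: b1_def)+
    obtain ds b' where 2: "exec add_digits
      (cfg (tp (?o # out) []) (tp l1' (tl ys @ 3 # r1)) t2 (tp [] [b1]) (tp l' (tl xs @ 3 # r)) R)
      (cfg (tp (rev ds @ ?o # out) []) (tp (rev (tl ys) @ l1') (3 # r1)) t2 (tp [] [b'])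
        (tp (rev (tl xs) @ l') (3 # r)) R)
      (2 * max (length (tl xs)) (length (tl ys)) + 1)"
      and ds: "b' \<le> 1" "add_list (tl xs) (tl ys) b1 = ds @ [Suc b']"
      using "1.IH"[OF False prems[unfolded b1_def]] unfolding b1_def by blast
    have "rev (tl ys) @ l1' = rev ys @ l1" "rev (tl xs) @ l' = rev xs @ l"
      by (cases ys; simp add: l1'_def) (cases xs; simp add: l'_def)
    note 2 = 2[unfolded this]
    have "exec add_digits
      (cfg (tp out []) (tp l1 (ys @ 3 # r1)) t2 (tp [] [b]) (tp l (xs @ 3 # r)) R)
      (cfg (tp (rev ds @ ?o # out) []) (tp (rev ys @ l1) (3 # r1)) t2 (tp [] [b'])
        (tp (rev xs @ l) (3 # r)) R)
      (2 * max (length xs) (length ys) + 1)"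
      unfolding add_digits_def
      by (rule exec_whl_True[OF g _ 1 2[unfolded add_digits_def]])
         (use False "1.prems" in \<open>cases xs; cases ys; auto\<close>)+
    moreover have "add_list xs ys b = (?o # ds) @ [Suc b']"
      unfolding add_list.simps[of xs ys b] using False ds(2) unfolding b1_def by simp
    ultimately show ?thesis
      using ds(1) by - (rule exI[of _ "?o # ds"], rule exI[of _ b'], simp)
  qed
qed

definition add_step :: turing_machine where
  "add_step = add_digits ;;
     act [(0, \<lambda>f. (if f 3 = 1 then 2 else 1, MoveRight)), (3, \<lambda>f. (0, Stay))] ;; strip 0 ;;
     act [(0, \<lambda>f. (3, MoveRight)), (4, \<lambda>f. (f 4, MoveRight))] ;; goleft 1 (\<lambda>a. a \<noteq> 0)"

lemma good_add_step [simp]: "good add_step"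
  unfolding add_step_def by simp

lemma exec_add_step:
  assumes "hd0 out \<noteq> 1" "length (bits T) \<le> N" "length (bits k) \<le> N"
  shows "exec add_step
    (cfg (tp out []) (tp [] (bits T @ [3])) t2 blank (tp l (enc_nat k @ r)) R)
    (cfg (tp (rev (enc_nat (k + T)) @ out) []) (tp [] (bits T @ [3])) t2 blank
      (tp (rev (enc_nat k) @ l) r) R) (6 * N + 12)"
proof -
  obtain ds b' where 1: "exec add_digits
    (cfg (tp out []) (tp [] (bits T @ [3])) t2 (tp [] [0]) (tp l (bits k @ 3 # r)) R)
    (cfg (tp (rev ds @ out) []) (tp (rev (bits T) @ []) [3]) t2 (tp [] [b'])
      (tp (rev (bits k) @ l) (3 # r)) R)
    (2 * max (length (bits k)) (length (bits T)) + 1)"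
    and b': "b' \<le> 1" and ds: "add_list (bits k) (bits T) 0 = ds @ [Suc b']"
    using exec_add_digits[of "bits k" "bits T" 0 out "[]" "[]" t2 l r R] bits_ne by auto
  have props: "set (ds @ [Suc b']) \<subseteq> {1, 2}" "bits_value (ds @ [Suc b']) = k + T"
    "length (ds @ [Suc b']) = Suc (max (length (bits k)) (length (bits T)))"
    using add_list_props[OF bits_symbols bits_symbols, of 0 k T] unfolding ds by auto
  have len: "length (ds @ [Suc b']) \<le> N + 1" using props(3) assms by simp
  have b'01: "b' = 0 \<or> b' = 1" using b' by auto
  have 2: "exec (act [(0, \<lambda>f. (if f 3 = 1 then 2 else 1, MoveRight)), (3, \<lambda>f. (0, Stay))])
    (cfg (tp (rev ds @ out) []) (tp (rev (bits T) @ []) [3]) t2 (tp [] [b'])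
      (tp (rev (bits k) @ l) (3 # r)) R)
    (cfg (tp (rev (ds @ [Suc b']) @ out) []) (tp (rev (bits T)) [3]) t2 blank
      (tp (rev (bits k) @ l) (3 # r)) R) 1"
    by (rule exec_act) (use b'01 in \<open>auto simp: numeral_2_eq_2\<close>)
  have 3: "exec (strip 0)
    (cfg (tp (rev (ds @ [Suc b']) @ out) []) (tp (rev (bits T)) [3]) t2 blank
      (tp (rev (bits k) @ l) (3 # r)) R)
    (cfg (tp (rev (bits (k + T)) @ out) []) (tp (rev (bits T)) [3]) t2 blank
      (tp (rev (bits k) @ l) (3 # r)) R) (2 * N + 5)"
    by (rule exec_strip[where xs = "ds @ [Suc b']" and l = out])
       (use assms(1) props(1,2) len in \<open>simp_all only: cfg_simps\<close>, simp_all)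
  have 4: "exec (act [(0, \<lambda>f. (3, MoveRight)), (4, \<lambda>f. (f 4, MoveRight))])
    (cfg (tp (rev (bits (k + T)) @ out) []) (tp (rev (bits T)) [3]) t2 blank
      (tp (rev (bits k) @ l) (3 # r)) R)
    (cfg (tp (rev (enc_nat (k + T)) @ out) []) (tp (rev (bits T)) [3]) t2 blank
      (tp (rev (enc_nat k) @ l) r) R) 1"
    by (rule exec_act) (simp_all add: enc_nat_def)
  have 5: "exec (goleft 1 (\<lambda>a. a \<noteq> 0))
    (cfg (tp (rev (enc_nat (k + T)) @ out) []) (tp (rev (bits T)) [3]) t2 blank
      (tp (rev (enc_nat k) @ l) r) R)
    (cfg (tp (rev (enc_nat (k + T)) @ out) []) (tp [] (bits T @ [3])) t2 blank
      (tp (rev (enc_nat k) @ l) r) R) (2 * N + 3)"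
    by (rule exec_goleft[where ls = "rev (bits T)" and l = "[]" and r = "[3]"])
       (use assms in \<open>auto dest: bits_symbolsD\<close>)
  have "exec add_step
    (cfg (tp out []) (tp [] (bits T @ [3])) t2 (tp [] [0]) (tp l (bits k @ 3 # r)) R)
    (cfg (tp (rev (enc_nat (k + T)) @ out) []) (tp [] (bits T @ [3])) t2 blank
      (tp (rev (enc_nat k) @ l) r) R) (6 * N + 12)"
    unfolding add_step_def
    by (rule exec_mono[OF exec_seqI[OF 1 exec_seqI[OF 2 exec_seqI[OF 3 exec_seqI[OF 4 5]]]]])
       (use assms in simp_all)
  then show ?thesis by (simp add: enc_nat_append)
qed

text \<open>
  In a schedule the tokens are the numbers (\<open>Some\<close>) and the end-of-list symbols (\<open>None\<close>).
\<close>

fun enc_token :: "nat option \<Rightarrow> nat list" where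
  "enc_token None = [4]"
| "enc_token (Some k) = enc_nat k"

definition shift_token :: "nat \<Rightarrow> nat option \<Rightarrow> nat list" where
  "shift_token T tok = enc_token (map_option (\<lambda>k. k + T) tok)"

lemma shift_token_simps [simp]:
  "shift_token T None = [4]" "shift_token T (Some k) = enc_nat (k + T)"
  by (simp_all add: shift_token_def)

definition post_step :: turing_machine where
  "post_step = ite (\<lambda>f. f 4 = 4)
     (act [(0, \<lambda>f. (4, MoveRight)), (4, \<lambda>f. (f 4, MoveRight))]) add_step"

lemma good_post_step [simp]: "good post_step"
  unfolding post_step_def by simp

lemma exec_post_step:
  assumes "hd0 out \<noteq> 1" "length (bits T) \<le> N" "\<forall>k. tok = Some k \<longrightarrow> length (bits k) \<le> N"
  shows "exec post_step
    (cfg (tp out []) (tp [] (bits T @ [3])) t2 blank (tp l (enc_token tok @ r)) R)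
    (cfg (tp (rev (shift_token T tok) @ out) []) (tp [] (bits T @ [3])) t2 blank
      (tp (rev (enc_token tok) @ l) r) R) (6 * N + 13)"
proof (cases tok)
  case None
  have 1: "exec (act [(0, \<lambda>f. (4, MoveRight)), (4, \<lambda>f. (f 4, MoveRight))])
    (cfg (tp out []) (tp [] (bits T @ [3])) t2 blank (tp l (4 # r)) R)
    (cfg (tp (4 # out) []) (tp [] (bits T @ [3])) t2 blank (tp (4 # l) r) R) 1"
    by (rule exec_act) simp_all
  show ?thesis
    unfolding post_step_def None by (rule exec_ite_True[where ?t1.0 = 1]) (use 1 in simp_all)
next
  case (Some k)
  have 1: "exec add_step
    (cfg (tp out []) (tp [] (bits T @ [3])) t2 blank (tp l (enc_nat k @ r)) R)
    (cfg (tp (rev (enc_nat (k + T)) @ out) []) (tp [] (bits T @ [3])) t2 blank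
      (tp (rev (enc_nat k) @ l) r) R) (6 * N + 12)"
    by (rule exec_add_step) (use assms Some in auto)
  show ?thesis
    unfolding post_step_def Some
    by (rule exec_ite_False[where ?t1.0 = "6 * N + 12"])
       (use 1 hd0_bits in \<open>simp_all add: enc_nat_append\<close>)
qed

text \<open>The loop ends at the blank that follows the output of the given machine. Thus the
  nesting of the lists need not be tracked, and end-of-list symbols are merely copied.\<close>

definition post_loop :: turing_machine where
  "post_loop = whl (\<lambda>f. f 4 \<noteq> 0) post_step"

lemma good_post_loop [simp]: "good post_loop"
  unfolding post_loop_def by simp

lemma exec_post_loop:
  assumes "hd0 out \<noteq> 1" "length (bits T) \<le> N" "\<forall>k. Some k \<in> set tokens \<longrightarrow> length (bits k) \<le> N"
    "hd0 r = 0"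
  shows "exec post_loop
    (cfg (tp out []) (tp [] (bits T @ [3])) t2 blank (tp l (concat (map enc_token tokens) @ r)) R)
    (cfg (tp (rev (concat (map (shift_token T) tokens)) @ out) []) (tp [] (bits T @ [3])) t2 blank
      (tp (rev (concat (map enc_token tokens)) @ l) r) R) (length tokens * (6 * N + 14) + 1)"
  using assms(1,3)
proof (induction tokens arbitrary: out l)
  case Nil
  let ?c = "cfg (tp out []) (tp [] (bits T @ [3])) t2 blank (tp l r) R"
  have "exec post_loop ?c ?c 1"
    unfolding post_loop_def by (rule exec_whl_False) (simp add: assms)
  then show ?case by simp
next
  case (Cons tok tokens)
  let ?r = "concat (map enc_token tokens) @ r"
  have 1: "exec post_step
    (cfg (tp out []) (tp [] (bits T @ [3])) t2 blank (tp l (enc_token tok @ ?r)) R)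
    (cfg (tp (rev (shift_token T tok) @ out) []) (tp [] (bits T @ [3])) t2 blank
      (tp (rev (enc_token tok) @ l) ?r) R) (6 * N + 13)"
    by (rule exec_post_step) (use Cons.prems assms(2) in auto)
  have hd: "hd0 (rev (shift_token T tok) @ out) \<noteq> 1"
    by (cases tok) (simp_all add: enc_nat_def)
  have "\<forall>k. Some k \<in> set tokens \<longrightarrow> length (bits k) \<le> N" using Cons.prems by simp
  note 2 = Cons.IH[OF hd this, of "rev (enc_token tok) @ l"]
  have nz: "hd0 (enc_token tok @ ?r) \<noteq> 0"
    using hd0_bits by (cases tok) (simp_all add: enc_nat_append)
  have "exec post_loop
    (cfg (tp out []) (tp [] (bits T @ [3])) t2 blank (tp l (enc_token tok @ ?r)) R)
    (cfg (tp (rev (concat (map (shift_token T) tokens)) @ rev (shift_token T tok) @ out) [])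
      (tp [] (bits T @ [3])) t2 blank
      (tp (rev (concat (map enc_token tokens)) @ rev (enc_token tok) @ l) r) R)
    (length (tok # tokens) * (6 * N + 14) + 1)"
    unfolding post_loop_def
    by (rule exec_whl_True[OF good_post_step _ 1 2[unfolded post_loop_def]])
       (use nz in simp_all)
  then show ?case by simp
qed

text \<open>On tape 0 the head stands on the last symbol of the input. The first move passes it, and
  the second leaves a blank cell behind it, at which the final \<open>goleft\<close> stops. The same
  blank guards the first number against \<open>strip\<close>.\<close>

definition postprocess :: turing_machine where
  "postprocess = move_head 0 MoveRight ;; move_head 0 MoveRight ;; post_loop ;; goleft 0 (\<lambda>a. a \<noteq> 0)"

lemma good_postprocess [simp]: "good postprocess"
  unfolding postprocess_def by simp

lemma exec_postprocess:
  assumes "length (bits T) \<le> N" "\<forall>k. Some k \<in> set tokens \<longrightarrow> length (bits k) \<le> N" "hd0 r = 0"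
    and y': "y' = concat (map (shift_token T) tokens)" and nz: "0 \<notin> set y'"
  shows "\<exists>c' l'. exec postprocess
    (cfg (tp l [4]) (tp [] (bits T @ [3])) t2 blank (tp l4 (concat (map enc_token tokens) @ r)) R) c'
    (length tokens * (6 * N + 14) + 2 * length y' + 6) \<and> c' 0 = tp l' y'"
proof -
  let ?t1 = "tp [] (bits T @ [3])"
  let ?t4 = "tp l4 (concat (map enc_token tokens) @ r)"
  let ?t4' = "tp (rev (concat (map enc_token tokens)) @ l4) r"
  have 1: "exec (move_head 0 MoveRight) (cfg (tp l [4]) ?t1 t2 blank ?t4 R)
    (cfg (tp (4 # l) []) ?t1 t2 blank ?t4 R) 1"
    by (rule exec_move_head) simp_all
  have 2: "exec (move_head 0 MoveRight) (cfg (tp (4 # l) []) ?t1 t2 blank ?t4 R)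
    (cfg (tp (0 # 4 # l) []) ?t1 t2 blank ?t4 R) 1"
    by (rule exec_move_head) simp_all
  have "hd0 (0 # 4 # l) \<noteq> 1" by simp
  note 3 = exec_post_loop[OF this assms(1-3), of t2 l4 R, folded y']
  have 4: "exec (goleft 0 (\<lambda>a. a \<noteq> 0)) (cfg (tp (rev y' @ 0 # 4 # l) []) ?t1 t2 blank ?t4' R)
    (cfg (tp (0 # 4 # l) y') ?t1 t2 blank ?t4' R) (2 * length y' + 3)"
    by (rule exec_goleft[where ls = "rev y'" and l = "0 # 4 # l" and r = "[]"])
       (use nz in \<open>auto intro: gr0I\<close>)
  have "exec postprocess (cfg (tp l [4]) ?t1 t2 blank ?t4 R) (cfg (tp (0 # 4 # l) y') ?t1 t2 blank ?t4' R)
    (length tokens * (6 * N + 14) + 2 * length y' + 6)"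
    unfolding postprocess_def
    by (rule exec_mono[OF exec_seqI[OF 1 exec_seqI[OF 2 exec_seqI[OF 3 4]]]]) simp_all
  then show ?thesis by (intro exI conjI) (assumption, simp)
qed

section \<open>Running the given machine on its own tapes\<close>

definition lift :: "turing_machine \<Rightarrow> turing_machine" where
  "lift A = \<lparr>num_tapes = K, num_states = num_states A, num_symbols = s,
     transition = \<lambda>q as. case transition A q (drop 4 as) of
       (q', acts) \<Rightarrow> (q', idle (take 4 as) @ acts)\<rparr>"

lemma good_lift:
  assumes "wf_tm A" "num_tapes A = K - 4" "num_symbols A = s"
  shows "good (lift A)"
  unfolding good_iff
proof (intro conjI allI impI)
  fix q as assume as: "q < num_states (lift A) \<and> length as = K \<and> set as \<subseteq> {..<s}"
  obtain q' acts where tr: "transition A q (drop 4 as) = (q', acts)"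
    by (cases "transition A q (drop 4 as)")
  have *: "q < num_states A \<and> length (drop 4 as) = num_tapes A \<and>
      set (drop 4 as) \<subseteq> {..<num_symbols A}"
    using as assms(2,3) set_drop_subset[of 4 as] by (auto simp: lift_def)
  have acts: "q' \<le> num_states A" "length acts = num_tapes A" "\<forall>(a, d) \<in> set acts. a < num_symbols A"
    using assms(1)[unfolded wf_tm_def, THEN conjunct2, THEN conjunct2, rule_format, OF *]
    by (simp_all add: tr)
  have "\<forall>(a, d) \<in> set (idle (take 4 as)). a < s"
    using as set_take_subset[of 4 as] by (auto simp: idle_def)
  then show "case transition (lift A) q as of (q', acts) \<Rightarrow>
        q' \<le> num_states (lift A) \<and> length acts = K \<and> (\<forall>(a, d) \<in> set acts. a < s)"
    using acts as assms(2,3) K5 by (auto simp: lift_def tr idle_def)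
qed (simp_all add: lift_def)

definition lift_conf :: "aconf \<Rightarrow> aconf \<Rightarrow> aconf" where
  "lift_conf d c = (\<lambda>i. if i < 4 then d i else c (i - 4))"

lemma astep_lift:
  assumes "num_tapes A = K - 4" "astep A (q, c) = (q', c')"
  shows "astep (lift A) (q, lift_conf d c) = (q', lift_conf d c')"
proof (cases "q < num_states A")
  case False
  then have "num_states (lift A) \<le> q" "q' = q" "c' = c" using assms by (auto simp: lift_def)
  then show ?thesis by simp
next
  case True
  let ?as = "map (\<lambda>i. aread (lift_conf d c i)) [0..<K]"
  have drop: "drop 4 ?as = map (\<lambda>i. aread (c i)) [0..<num_tapes A]"
    by (rule nth_equalityI) (auto simp: assms(1) lift_conf_def add.commute)
  obtain acts where tr: "transition A q (map (\<lambda>i. aread (c i)) [0..<num_tapes A]) = (q', acts)"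
    and c': "c' = (\<lambda>i. if i < num_tapes A then aact (acts ! i) (c i) else c i)"
    using assms(2) True by (auto split: prod.splits)
  have 1: "num_states (lift A) = num_states A" "num_tapes (lift A) = K" by (simp_all add: lift_def)
  have 2: "transition (lift A) q ?as = (q', idle (take 4 ?as) @ acts)"
    unfolding lift_def by (simp add: drop tr del: drop_map)
  have nth: "aact ((idle (take 4 ?as) @ acts) ! i) (lift_conf d c i) = lift_conf d c' i"
    if "i < K" for i
  proof (cases "i < 4")
    case True
    then show ?thesis using that
      by (simp add: nth_append idle_def lift_conf_def)
  next
    case False
    then have "i - 4 < num_tapes A" "min (length ?as) 4 = 4" using assms(1) that by auto
    then show ?thesis using that False
      by (simp add: nth_append idle_def lift_conf_def c')
  qed
  have "(\<lambda>i. if i < K then aact ((idle (take 4 ?as) @ acts) ! i) (lift_conf d c i)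
      else lift_conf d c i) = lift_conf d c'"
  proof
    fix i show "(if i < K then aact ((idle (take 4 ?as) @ acts) ! i) (lift_conf d c i)
      else lift_conf d c i) = lift_conf d c' i"
    proof (cases "i < K")
      case False
      then have "\<not> i < 4" "\<not> i - 4 < num_tapes A" using assms(1) K5 by auto
      then show ?thesis using False by (simp add: lift_conf_def c')
    qed (use nth in simp)
  qed
  then show ?thesis unfolding astep.simps 1 2 using True by simp
qed

lemma exec_lift:
  assumes "num_tapes A = K - 4" "exec A c c' t"
  shows "exec (lift A) (lift_conf d c) (lift_conf d c') t"
proof -
  have steps: "(astep (lift A) ^^ n) (q, lift_conf d c) = (q', lift_conf d c')"
    if "(astep A ^^ n) (q, c) = (q', c')" for n q q' c c'
    using that
  proof (induction n arbitrary: q' c')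
    case 0
    then show ?case by simp
  next
    case (Suc n)
    obtain q1 c1 where 1: "(astep A ^^ n) (q, c) = (q1, c1)" by (cases "(astep A ^^ n) (q, c)")
    have "astep A (q1, c1) = (q', c')" using Suc.prems 1 by (simp del: astep.simps)
    from astep_lift[OF assms(1) this] Suc.IH[OF 1] show ?case by (simp del: astep.simps)
  qed
  obtain t' where t': "t' \<le> t" "(astep A ^^ t') (0, c) = (num_states A, c')"
    using assms(2) by (auto simp: exec_def)
  have "num_states (lift A) = num_states A" by (simp add: lift_def)
  with steps[OF t'(2)] t'(1) show ?thesis unfolding exec_def by auto
qed

lemma lift_conf_cfg:
  "lift_conf (cfg t0 t1 t2 t3 t4 R) c = cfg t0 t1 t2 t3 (c 0) (\<lambda>i. c (i - 4))"
  by (auto simp: lift_conf_def cfg_def fun_eq_iff)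

end

context machine_combinators
begin

definition reduction :: "turing_machine \<Rightarrow> turing_machine" where
  "reduction A = preprocess ;; lift A ;; postprocess"

lemma good_reduction:
  assumes "wf_tm A" "num_tapes A = K - 4" "num_symbols A = s"
  shows "good (reduction A)"
  unfolding reduction_def using good_lift[OF assms] by simp

lemma tm_computes_within_reduction:
  assumes A: "wf_tm A" "num_tapes A = K - 4" "num_symbols A = s"
    and valid: "\<forall>zs \<in> set css. valid_chain T zs \<and> length zs \<le> m"
    and x: "x = enc_nat T @ enc_list (enc_list enc_nat) css" "set x \<subseteq> {..<5}"
    and x': "x' = enc_list (enc_list enc_weight) (map (chain_weights T) css)" "set x' \<subseteq> {..<5}"
    and comp: "tm_computes_within A x' (concat (map enc_token tokens)) t"
    and N: "length (bits T) \<le> N" "\<forall>k. Some k \<in> set tokens \<longrightarrow> length (bits k) \<le> N"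
    and y': "y' = concat (map (shift_token T) tokens)" "0 \<notin> set y'"
  shows "tm_computes_within (reduction A) x y'
    (length css * (m * (10 * length (bits T) + 21) + 12 * length (bits T) + 31)
      + 4 * length (bits T) + 2 * length x' + 20 + (t + (length tokens * (6 * N + 14) + 2 * length y' + 6)))"
proof -
  let ?R = "\<lambda>_. blank"
  let ?t1 = "tp [] (bits T @ [3])"
  obtain l1 where 1: "exec preprocess (start_conf x) (cfg (tp l1 [4]) ?t1 blank blank (tp [] x') ?R)
    (length css * (m * (10 * length (bits T) + 21) + 12 * length (bits T) + 31)
      + 4 * length (bits T) + 2 * length x' + 20)"
    using exec_preprocess[OF valid x(1) x'(1)] by blast
  obtain c l r where c: "exec A (start_conf x') c t" "c 0 = tp l (concat (map enc_token tokens) @ r)"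
    and r: "aread (tp [] r) = 0"
    using exec_of_tm_computes_within[OF A(1) x'(2) comp] by blast
  let ?d = "cfg (tp l1 [4]) ?t1 blank blank blank ?R"
  \<comment> \<open>After preprocessing, all tapes from 5 on are blank and tape 4 holds
    \<open>x'\<close> with the head at its start. This is exactly the start configuration of
    \<open>A\<close>, shifted by four tapes.\<close>
  have "lift_conf ?d (start_conf x') = cfg (tp l1 [4]) ?t1 blank blank (tp [] x') ?R"
    unfolding lift_conf_cfg by (auto simp: cfg_def start_conf_def fun_eq_iff)
  then have 2: "exec (lift A) (cfg (tp l1 [4]) ?t1 blank blank (tp [] x') ?R)
      (cfg (tp l1 [4]) ?t1 blank blank (tp l (concat (map enc_token tokens) @ r)) (\<lambda>i. c (i - 4))) t"
    using exec_lift[OF A(2) c(1), of ?d] unfolding lift_conf_cfg c(2) by simp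
  have "hd0 r = 0" using r by simp
  then obtain c' l' where 3: "exec postprocess
      (cfg (tp l1 [4]) ?t1 blank blank (tp l (concat (map enc_token tokens) @ r)) (\<lambda>i. c (i - 4))) c'
      (length tokens * (6 * N + 14) + 2 * length y' + 6)" and c': "c' 0 = tp l' y'"
    using exec_postprocess[OF N _ y'] by blast
  have "exec (reduction A) (start_conf x) c'
    (length css * (m * (10 * length (bits T) + 21) + 12 * length (bits T) + 31)
      + 4 * length (bits T) + 2 * length x' + 20 + (t + (length tokens * (6 * N + 14) + 2 * length y' + 6)))"
    unfolding reduction_def
    by (rule exec_seqI[OF 1 exec_seqI[OF 2 3]]) (use good_lift[OF A] in simp_all)
  moreover have "wf_tm (reduction A)" using good_reduction[OF A] by (simp add: good_def)
  ultimately show ?thesis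
    using tm_computes_within_exec c' y'(2) x(2) by blast
qed

end

section \<open>Min-Age as a Min-WCS problem\<close>

text \<open>On age instances no subtraction is truncated for \<open>j\<close> in the chain:
  birthdays increase, and the birthday before the last lies strictly below the start time. In
  particular the last weight is positive.\<close>

definition wcs_of :: "age_instance \<Rightarrow> wcs_instance" where
  "wcs_of I = \<lparr>chains = receivers I, chain_length = messages I,
     weight = \<lambda>i j. of_nat (if j = messages I i
       then 2 * (start_time I - birthday I i (j - 1)) - 1
       else 2 * (birthday I i j - birthday I i (j - 1)))\<rparr>"

lemma wcs_of_instance: "I \<in> age_instances \<Longrightarrow> wcs_of I \<in> wcs_instances"
  by (auto simp: age_instances_def wcs_instances_def wcs_of_def)

text \<open>Translation is a bijection between the time ranges and preserves order. Equality is
  required on the chains only, so that truncated subtraction of the start time can serve as the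
  inverse translation.\<close>

lemma chain_schedules_shift:
  assumes eq: "\<And>i j. i \<in> {1..n} \<Longrightarrow> j \<in> {1..len i} \<Longrightarrow> S i j = S' i j + t"
  shows "S \<in> chain_schedules n len t \<longleftrightarrow> S' \<in> chain_schedules n len 0"
proof -
  let ?D = "SIGMA i:{1..n}. {1..len i}"
  let ?T = "\<Sum>i = 1..n. len i"
  let ?f = "\<lambda>(i, j). S i j" and ?f' = "\<lambda>(i, j). S' i j"
  have shift: "bij_betw (\<lambda>x. x + t) {0 + 1..0 + ?T} {t + 1..t + ?T}"
    by (rule bij_betw_byWitness[where f' = "\<lambda>x. x - t"]) auto
  have cong: "bij_betw ?f ?D A \<longleftrightarrow> bij_betw ((\<lambda>x. x + t) \<circ> ?f') ?D A" for A
    by (rule bij_betw_cong) (use eq in auto)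
  have "bij_betw ?f ?D {t + 1..t + ?T} \<longleftrightarrow> bij_betw ?f' ?D {0 + 1..0 + ?T}"
  proof
    assume *: "bij_betw ?f' ?D {0 + 1..0 + ?T}"
    show "bij_betw ?f ?D {t + 1..t + ?T}"
      unfolding cong using bij_betw_trans[OF * shift] .
  next
    assume *: "bij_betw ?f ?D {t + 1..t + ?T}"
    have "?f' ` ?D \<subseteq> {0 + 1..0 + ?T}"
    proof
      fix y assume "y \<in> ?f' ` ?D"
      then obtain i j where ij: "i \<in> {1..n}" "j \<in> {1..len i}" "y = S' i j" by auto
      have "S i j \<in> {t + 1..t + ?T}" using bij_betwE[OF *] ij(1,2) by force
      then show "y \<in> {0 + 1..0 + ?T}" using eq[OF ij(1,2)] ij(3) by auto
    qed
    from bij_betw_comp_iff2[OF shift this] show "bij_betw ?f' ?D {0 + 1..0 + ?T}"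
      using * unfolding cong by blast
  qed
  moreover have "strict_mono_on {1..len i} (S i) \<longleftrightarrow> strict_mono_on {1..len i} (S' i)"
    if "i \<in> {1..n}" for i
    using eq[OF that] by (auto simp: strict_mono_on_def)
  ultimately show ?thesis by (auto simp: chain_schedules_def)
qed

section \<open>Total age of one receiver\<close>

lemma lm_eqI:
  assumes "k \<le> messages I i" "k = 0 \<or> S i k \<le> t" "k < messages I i \<Longrightarrow> t < S i (Suc k)"
    and mono: "strict_mono_on {1..messages I i} (S i)"
  shows "lm I S i t = k"
  unfolding lm_def
proof (rule Max_eqI)
  fix j assume j: "j \<in> {j \<in> {0..messages I i}. j = 0 \<or> S i j \<le> t}"
  show "j \<le> k"
  proof (rule ccontr)
    assume "\<not> j \<le> k"
    then have "Suc k \<le> j" "k < messages I i" using j by auto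
    then have "S i (Suc k) \<le> S i j"
      using strict_mono_on_leD[OF mono, of "Suc k" j] j by auto
    then show False using assms(3) j \<open>k < messages I i\<close> \<open>Suc k \<le> j\<close> by auto
  qed
qed (use assms in auto)

lemma sum_int_interval:
  assumes "u \<le> (v::nat)"
  shows "2 * (\<Sum>t = u..<v. int t) = int v * (int v - 1) - int u * (int u - 1)"
  using assms
proof (induction v rule: dec_induct)
  case base
  then show ?case by simp
next
  case (step v)
  then show ?case by (simp add: algebra_simps)
qed

lemma sum_by_parts:
  fixes b d :: "nat \<Rightarrow> int"
  assumes "d 0 = 0"
  shows "(\<Sum>j<Suc k. b j * (d (Suc j) - d j)) =
    b k * d (Suc k) - (\<Sum>j = 1..k. (b j - b (j - 1)) * d j)"
proof (induction k)
  case 0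
  then show ?case using assms by simp
next
  case (Suc k)
  then show ?case by (simp add: algebra_simps)
qed

lemma age_sum:
  assumes I: "I \<in> age_instances" and S: "S \<in> chain_schedules (receivers I) (messages I) (start_time I)"
    and i: "i \<in> {1..receivers I}"
    and S': "\<And>j. j \<in> {1..messages I i} \<Longrightarrow> S i j = S' j + start_time I"
  shows "2 * (\<Sum>t = start_time I..start_time I + total_messages I. age I S i t) =
    (\<Sum>j = 1..messages I i. int (if j = messages I i
       then 2 * (start_time I - birthday I i (j - 1)) - 1
       else 2 * (birthday I i j - birthday I i (j - 1))) * int (S' j)) + (int (S' (messages I i)))\<^sup>2"
proof -
  define M where "M = messages I i"
  define T0 where "T0 = start_time I"
  define b where "b = birthday I i"
  \<comment> \<open>Message 0 counts as delivered at the start time, so that the time axis splits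
    uniformly into intervals between deliveries. Accordingly \<open>d 0 = 0\<close>, as summation by
    parts requires.\<close>
  define s where "s = (\<lambda>j. if j = 0 then T0 else S i j)"
  define d where "d = (\<lambda>j. int (s j) - int T0)"
  have M: "1 \<le> M" and bm: "strict_mono_on {0..M} b" and bT: "b M \<le> T0"
    using I i by (auto simp: age_instances_def M_def b_def T0_def)
  have Sm: "strict_mono_on {1..M} (S i)"
    using S i by (auto simp: chain_schedules_def M_def)
  have Sr: "S i j \<in> {T0 + 1..T0 + total_messages I}" if "j \<in> {1..M}" for j
  proof -
    have "bij_betw (\<lambda>(i, j). S i j) (SIGMA i:{1..receivers I}. {1..messages I i})
        {T0 + 1..T0 + total_messages I}"
      using S by (simp add: chain_schedules_def T0_def total_messages_def)
    from bij_betwE[OF this] show ?thesis using i that by (force simp: M_def)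
  qed
  have step: "s k \<le> s (Suc k)" if "k < M" for k
  proof (cases "k = 0")
    case True
    then show ?thesis using Sr[of 1] M by (simp add: s_def)
  next
    case False
    then have "S i k < S i (Suc k)"
      using that by (intro strict_mono_onD[OF Sm]) auto
    then show ?thesis using False by (simp add: s_def)
  qed
  have age_eq: "age I S i t = int t - int (b k)" if "k < M" "s k \<le> t" "t < s (Suc k)" for k t
  proof -
    have "lm I S i t = k"
      by (rule lm_eqI) (use that Sm in \<open>auto simp: s_def M_def split: if_splits\<close>)
    then show ?thesis using that(1) by (simp add: age_def b_def M_def)
  qed
  have age_0: "age I S i t = 0" if "s M \<le> t" for t
  proof -
    have "lm I S i t = M"
      unfolding M_def
      by (rule lm_eqI) (use that Sm M in \<open>auto simp: s_def M_def[symmetric] split: if_splits\<close>)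
    then show ?thesis by (simp add: age_def M_def)
  qed
  \<comment> \<open>The intervals are half-open: at time \<open>s (Suc k)\<close> the newer message
    already counts, since \<open>lm\<close> asks for \<open>S i j \<le> t\<close>.\<close>
  have partial: "T0 \<le> s k \<and> 2 * (\<Sum>t = T0..<s k. age I S i t) =
      int (s k) * (int (s k) - 1) - int T0 * (int T0 - 1) -
      2 * (\<Sum>j<k. int (b j) * (d (Suc j) - d j))" if "k \<le> M" for k
    using that
  proof (induction k)
    case 0
    then show ?case by (simp add: s_def)
  next
    case (Suc k)
    then have k: "k < M" "T0 \<le> s k" "s k \<le> s (Suc k)" using step by auto
    have "(\<Sum>t = T0..<s (Suc k). age I S i t) =
        (\<Sum>t = T0..<s k. age I S i t) + (\<Sum>t = s k..<s (Suc k). age I S i t)"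
      using k by (simp add: sum.atLeastLessThan_concat)
    also have "(\<Sum>t = s k..<s (Suc k). age I S i t) = (\<Sum>t = s k..<s (Suc k). int t - int (b k))"
      by (rule sum.cong) (use k age_eq in auto)
    also have "\<dots> = (\<Sum>t = s k..<s (Suc k). int t) - (int (s (Suc k)) - int (s k)) * int (b k)"
      using k(3) by (simp add: sum_subtractf of_nat_diff)
    finally have "2 * (\<Sum>t = T0..<s (Suc k). age I S i t) =
        2 * (\<Sum>t = T0..<s k. age I S i t) + 2 * (\<Sum>t = s k..<s (Suc k). int t)
        - 2 * ((int (s (Suc k)) - int (s k)) * int (b k))"
      by simp
    then show ?case
      using Suc.IH k sum_int_interval[OF k(3)] by (simp add: d_def algebra_simps)
  qed
  have sM: "s M = S i M" using M by (simp add: s_def)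
  have le: "T0 \<le> s M" "s M \<le> Suc (T0 + total_messages I)" using Sr[of M] M sM by auto
  have "(\<Sum>t = T0..T0 + total_messages I. age I S i t) =
      (\<Sum>t = T0..<Suc (T0 + total_messages I). age I S i t)"
    by (simp only: atLeastLessThanSuc_atLeastAtMost)
  also have "\<dots> = (\<Sum>t = T0..<s M. age I S i t) + (\<Sum>t = s M..<Suc (T0 + total_messages I). age I S i t)"
    using le by (simp only: sum.atLeastLessThan_concat)
  also have "(\<Sum>t = s M..<Suc (T0 + total_messages I). age I S i t) = 0"
    by (rule sum.neutral) (use age_0 in auto)
  finally have total: "2 * (\<Sum>t = T0..T0 + total_messages I. age I S i t) =
      int (s M) * (int (s M) - 1) - int T0 * (int T0 - 1) -
      2 * (\<Sum>j<M. int (b j) * (d (Suc j) - d j))"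
    using partial[of M] by simp
  obtain k where k: "M = Suc k" using M by (cases M) auto
  have d: "d j = int (S' j)" if "j \<in> {1..M}" for j
    using S'[of j] that by (auto simp: d_def s_def M_def T0_def)
  have d0: "d 0 = 0" by (simp add: d_def s_def)
  note parts = sum_by_parts[of d "\<lambda>j. int (b j)" k, OF d0]
  have sMd: "int (s M) = d M + int T0" by (simp add: d_def)
  have bk: "b k < T0" using strict_mono_onD[OF bm, of k M] k bT by auto
  have w: "(\<Sum>j = 1..M. int (if j = M then 2 * (T0 - b (j - 1)) - 1
      else 2 * (b j - b (j - 1))) * int (S' j)) =
    2 * (\<Sum>j = 1..k. (int (b j) - int (b (j - 1))) * d j) + (2 * (int T0 - int (b k)) - 1) * d M"
  proof -
    have "(\<Sum>j = 1..M. int (if j = M then 2 * (T0 - b (j - 1)) - 1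
        else 2 * (b j - b (j - 1))) * int (S' j)) =
      (\<Sum>j = 1..k. int (if j = M then 2 * (T0 - b (j - 1)) - 1
        else 2 * (b j - b (j - 1))) * int (S' j)) + int (2 * (T0 - b k) - 1) * int (S' M)"
      by (simp add: k)
    also have "(\<Sum>j = 1..k. int (if j = M then 2 * (T0 - b (j - 1)) - 1
        else 2 * (b j - b (j - 1))) * int (S' j)) =
      (\<Sum>j = 1..k. 2 * ((int (b j) - int (b (j - 1))) * d j))"
    proof (rule sum.cong)
      fix j assume j: "j \<in> {1..k}"
      then have "b (j - 1) < b j" using k by (intro strict_mono_onD[OF bm]) auto
      then show "int (if j = M then 2 * (T0 - b (j - 1)) - 1 else 2 * (b j - b (j - 1))) * int (S' j)
          = 2 * ((int (b j) - int (b (j - 1))) * d j)"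
        using j k d[of j] by (simp add: of_nat_diff)
    qed simp
    \<comment> \<open>Both truncated subtractions are exact because of
      \<open>b k < T0\<close>.\<close>
    also have "int (2 * (T0 - b k) - 1) = 2 * (int T0 - int (b k)) - 1"
      using bk by (simp add: of_nat_diff)
    finally show ?thesis using d[of M] M by (simp add: sum_distrib_left)
  qed
  \<comment> \<open>With \<open>s M = d M + T0\<close> the quadratic terms become
    \<open>d M * d M + (2 * T0 - 1) * d M\<close>, as \<open>T0 * (T0 - 1)\<close> cancels. The
    boundary term of the summation by parts subtracts \<open>2 * b k * d M\<close>. No constant
    remains; an additive constant would spoil the approximation ratio.\<close>
  have "2 * (\<Sum>t = T0..T0 + total_messages I. age I S i t) =
    2 * (\<Sum>j = 1..k. (int (b j) - int (b (j - 1))) * d j) + (2 * (int T0 - int (b k)) - 1) * d M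
    + (d M)\<^sup>2"
    unfolding total sMd unfolding k parts by (simp add: algebra_simps power2_eq_square)
  also have "\<dots> = (\<Sum>j = 1..M. int (if j = M then 2 * (T0 - b (j - 1)) - 1
      else 2 * (b j - b (j - 1))) * int (S' j)) + (int (S' M))\<^sup>2"
    using w d[of M] M by simp
  finally show ?thesis unfolding M_def T0_def b_def .
qed

lemma wcs_eq_age:
  assumes I: "I \<in> age_instances" and S: "S \<in> chain_schedules (receivers I) (messages I) (start_time I)"
    and S': "\<And>i j. i \<in> {1..receivers I} \<Longrightarrow> j \<in> {1..messages I i} \<Longrightarrow> S i j = S' i j + start_time I"
  shows "real_of_rat (wcs (wcs_of I) S') = 2 * real_of_int (total_age I S)"
proof -
  let ?w = "\<lambda>i j. if j = messages I i then 2 * (start_time I - birthday I i (j - 1)) - 1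
       else 2 * (birthday I i j - birthday I i (j - 1))"
  let ?s = "\<lambda>i. (\<Sum>j = 1..messages I i. int (?w i j) * int (S' i j)) + (int (S' i (messages I i)))\<^sup>2"
  have "wcs (wcs_of I) S' = of_int (\<Sum>i = 1..receivers I. ?s i)"
    by (simp add: wcs_def wc_def cs_def wcs_of_def sum.distrib)
  also have "(\<Sum>i = 1..receivers I. ?s i) = (\<Sum>i = 1..receivers I.
      2 * (\<Sum>t = start_time I..start_time I + total_messages I. age I S i t))"
    by (rule sum.cong[OF refl], rule age_sum[OF I S, symmetric]) (use S' in auto)
  also have "\<dots> = 2 * total_age I S"
    by (simp add: total_age_def sum_distrib_left)
  finally have "wcs (wcs_of I) S' = of_int (2 * total_age I S)" .
  then have "real_of_rat (wcs (wcs_of I) S') = real_of_rat (of_int (2 * total_age I S))"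
    by (rule arg_cong)
  also have "\<dots> = real_of_int (2 * total_age I S)" by (rule of_rat_of_int_eq)
  finally show ?thesis by simp
qed

lemma approx_transfer:
  assumes I: "I \<in> age_instances" and S': "S' \<in> feasible min_wcs (wcs_of I)"
    and r: "1 \<le> r" and approx: "objective min_wcs (wcs_of I) S' \<le> r * optimum min_wcs (wcs_of I)"
  shows "(\<lambda>i j. S' i j + start_time I) \<in> feasible min_age I"
    "objective min_age I (\<lambda>i j. S' i j + start_time I) \<le> r * optimum min_age I"
proof -
  let ?S = "\<lambda>i j. S' i j + start_time I"
  have feas_wcs: "feasible min_wcs (wcs_of I) = chain_schedules (receivers I) (messages I) 0"
    by (simp add: min_wcs_def wcs_of_def)
  have feas_age: "feasible min_age I = chain_schedules (receivers I) (messages I) (start_time I)"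
    by (simp add: min_age_def)
  have obj_wcs: "objective min_wcs (wcs_of I) X = real_of_rat (wcs (wcs_of I) X)" for X
    by (simp add: min_wcs_def)
  have obj_age: "objective min_age I X = real_of_int (total_age I X)" for X
    by (simp add: min_age_def)
  show S: "?S \<in> feasible min_age I"
    using S' chain_schedules_shift[of "receivers I" "messages I" ?S S' "start_time I"]
    unfolding feas_wcs feas_age by blast
  \<comment> \<open>\<open>optimum\<close> is an infimum of reals, so \<open>cINF_lower\<close>
    below requires a lower bound of the objective values.\<close>
  have nonneg: "0 \<le> objective min_wcs (wcs_of I) X" for X
  proof -
    have "0 \<le> wcs (wcs_of I) X"
      unfolding wcs_def wc_def wcs_of_def by (auto intro!: add_nonneg_nonneg sum_nonneg)
    then show ?thesis unfolding obj_wcs by simp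
  qed
  \<comment> \<open>Every schedule for Min-Age, shifted back to start at 0, competes in Min-WCS with
    exactly twice its value.\<close>
  have "optimum min_wcs (wcs_of I) / 2 \<le> optimum min_age I"
    unfolding optimum_def[of min_age]
  proof (rule cINF_greatest)
    show "feasible min_age I \<noteq> {}" using S by auto
    fix X assume X: "X \<in> feasible min_age I"
    \<comment> \<open>Truncation does no harm on the chains, where all times exceed the start
      time.\<close>
    define X' where "X' = (\<lambda>i j. X i j - start_time I)"
    have eq: "X i j = X' i j + start_time I"
      if "i \<in> {1..receivers I}" "j \<in> {1..messages I i}" for i j
    proof -
      have "bij_betw (\<lambda>(i, j). X i j) (SIGMA i:{1..receivers I}. {1..messages I i})
          {start_time I + 1..start_time I + (\<Sum>i = 1..receivers I. messages I i)}"
        using X unfolding feas_age chain_schedules_def by simp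
      from bij_betwE[OF this] that have "start_time I + 1 \<le> X i j" by force
      then show ?thesis by (simp add: X'_def)
    qed
    have "X' \<in> feasible min_wcs (wcs_of I)"
      using X chain_schedules_shift[of "receivers I" "messages I" X X' "start_time I", OF eq]
      unfolding feas_wcs feas_age by blast
    then have "optimum min_wcs (wcs_of I) \<le> objective min_wcs (wcs_of I) X'"
      unfolding optimum_def by (intro cINF_lower bdd_belowI2[where m = 0] nonneg)
    also have "\<dots> = 2 * objective min_age I X"
      unfolding obj_wcs obj_age using X eq unfolding feas_age by (intro wcs_eq_age[OF I])
    finally show "optimum min_wcs (wcs_of I) / 2 \<le> objective min_age I X" by simp
  qed
  then have "r * optimum min_wcs (wcs_of I) / 2 \<le> r * optimum min_age I"
    using mult_left_mono[of "optimum min_wcs (wcs_of I) / 2" "optimum min_age I" r] r by simp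
  moreover have "objective min_wcs (wcs_of I) S' = 2 * objective min_age I ?S"
    unfolding obj_wcs obj_age using S unfolding feas_age by (intro wcs_eq_age[OF I]) auto
  ultimately show "objective min_age I ?S \<le> r * optimum min_age I"
    using approx by simp
qed

section \<open>Correctness and running time\<close>

definition birthdays :: "age_instance \<Rightarrow> nat list list" where
  "birthdays I = map (\<lambda>i. map (birthday I i) [0..<messages I i + 1]) [1..<receivers I + 1]"

lemma enc_age_eq: "enc_age I = enc_nat (start_time I) @ enc_list (enc_list enc_nat) (birthdays I)"
  by (simp add: enc_age_def birthdays_def)

text \<open>The offset \<open>k\<close> is the index of the birthday in the role of
  \<open>p\<close>. It must be general, since each step of the induction on the number
  \<open>d\<close> of remaining birthdays moves the window by one.\<close>

lemma weights_from_map: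
  "weights_from T (f k) (f (Suc k)) (map f [k + 2..<k + 2 + d]) =
    map (\<lambda>j. if j = k + 1 + d then 2 * (T - f (j - 1)) - 1 else 2 * (f j - f (j - 1)))
      [k + 1..<k + 2 + d]"
proof (induction d arbitrary: k)
  case 0
  then show ?case by simp
next
  case (Suc d)
  have "[k + 2..<k + 2 + Suc d] = (k + 2) # [Suc k + 2..<Suc k + 2 + d]"
    "[k + 1..<k + 2 + Suc d] = (k + 1) # [Suc k + 1..<Suc k + 2 + d]"
    by (simp_all add: upt_conv_Cons)
  then show ?case using Suc.IH[of "Suc k"] by simp
qed

declare upt_Suc [simp del]

lemma wcs_of_simps [simp]: "chains (wcs_of I) = receivers I" "chain_length (wcs_of I) = messages I"
  by (simp_all add: wcs_of_def)

text \<open>The link between machine and mathematics: what \<open>preprocess\<close> leaves on tape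
  4 is an input that the machine for Min-WCS must handle. One side takes the weights from a window
  sliding over the birthdays, the other from a formula in the index.\<close>

lemma enc_wcs_of:
  assumes "I \<in> age_instances"
  shows "enc_wcs (wcs_of I) = enc_list (enc_list enc_weight) (map (chain_weights (start_time I)) (birthdays I))"
proof -
  have "enc_list enc_rat (map (weight (wcs_of I) i) [1..<messages I i + 1]) =
      enc_list enc_weight (chain_weights (start_time I) (map (birthday I i) [0..<messages I i + 1]))"
    if i: "i \<in> {1..receivers I}" for i
  proof -
    have "1 \<le> messages I i" using assms i by (auto simp: age_instances_def)
    then obtain d where d: "messages I i = Suc d" by (cases "messages I i") auto
    let ?f = "birthday I i"
    have "[0..<messages I i + 1] = 0 # Suc 0 # [0 + 2..<0 + 2 + d]"
      by (simp add: d upt_conv_Cons del: upt_Suc)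
    then have "chain_weights (start_time I) (map ?f [0..<messages I i + 1]) =
        weights_from (start_time I) (?f 0) (?f (Suc 0)) (map ?f [0 + 2..<0 + 2 + d])"
      by simp
    also have "\<dots> = map (\<lambda>j. if j = messages I i then 2 * (start_time I - ?f (j - 1)) - 1
        else 2 * (?f j - ?f (j - 1))) [1..<messages I i + 1]"
      unfolding weights_from_map by (simp add: d)
    finally show ?thesis
      by (simp add: enc_list_def wcs_of_def enc_weight_def comp_def del: of_nat_mult)
  qed
  then have m: "map (\<lambda>i. enc_list enc_rat (map (weight (wcs_of I) i) [1..<messages I i + 1]))
        [1..<receivers I + 1] =
      map (\<lambda>i. enc_list enc_weight (chain_weights (start_time I)
        (map (birthday I i) [0..<messages I i + 1]))) [1..<receivers I + 1]"
    by (intro map_cong) auto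
  have e: "enc_wcs (wcs_of I) = concat (map (\<lambda>i. enc_list enc_rat
      (map (weight (wcs_of I) i) [1..<messages I i + 1])) [1..<receivers I + 1]) @ [4]"
    by (simp add: enc_wcs_def enc_list_def[of "enc_list enc_rat"] comp_def)
  show ?thesis
    unfolding e m by (simp add: birthdays_def enc_list_def[of "enc_list enc_weight"] comp_def)
qed

definition tokens :: "nat list list \<Rightarrow> nat option list" where
  "tokens nss = concat (map (\<lambda>ns. map Some ns @ [None]) nss) @ [None]"

lemma concat_map_tokens:
  "concat (map f (tokens nss)) =
    concat (map (\<lambda>ns. concat (map (\<lambda>k. f (Some k)) ns) @ f None) nss) @ f None"
proof -
  have "concat (map f (concat (map (\<lambda>ns. map Some ns @ [None]) nss))) =
      concat (map (\<lambda>ns. concat (map (\<lambda>k. f (Some k)) ns) @ f None) nss)"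
    by (induction nss) (simp_all add: comp_def)
  then show ?thesis by (simp add: tokens_def)
qed

lemma set_tokens: "Some k \<in> set (tokens nss) \<longleftrightarrow> (\<exists>ns \<in> set nss. k \<in> set ns)"
  by (auto simp: tokens_def)

section \<open>Bounds on the lengths of encodings\<close>

lemma length_tokens:
  "\<forall>ns \<in> set nss. length ns \<le> m \<Longrightarrow> length (tokens nss) \<le> length nss * (m + 1) + 1"
  by (induction nss) (auto simp: tokens_def)

text \<open>This crude bound serves for completion times, which are at most quadratic in the input
  length. Start times and birthdays are bounded through their own encodings instead.\<close>

lemma length_bits_le: "length (bits k) \<le> k"
proof (induction k rule: less_induct)
  case (less k)
  show ?case
  proof (cases "k = 0")
    case False
    then have "k div 2 < k" by simp
    moreover from less.IH[OF this] have "length (bits (k div 2)) \<le> k div 2" .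
    ultimately show ?thesis using False by (simp add: bits.simps[of k])
  qed simp
qed

text \<open>The digitwise sum represents \<open>k + m\<close> with one digit more than the longer
  summand, and the canonical numeral is a prefix of it.\<close>

lemma length_bits_add: "length (bits (k + m)) \<le> Suc (max (length (bits k)) (length (bits m)))"
proof -
  note props = add_list_props[OF bits_symbols bits_symbols, of 0 k m, simplified]
  then obtain n where "add_list (bits k) (bits m) 0 = bits (k + m) @ replicate n 1"
    using bits_bits_value[of "add_list (bits k) (bits m) 0"] by auto
  then have "length (bits (k + m)) \<le> length (add_list (bits k) (bits m) 0)" by simp
  then show ?thesis using props by simp
qed

lemma length_concat_map_le:
  "\<forall>x \<in> set xs. length (f x) \<le> B \<Longrightarrow> length (concat (map f xs)) \<le> length xs * B"
  by (induction xs) auto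

lemma length_enc_list_le:
  "\<forall>x \<in> set xs. length (f x) \<le> B \<Longrightarrow> length (enc_list f xs) \<le> length xs * B + 1"
  using length_concat_map_le[of xs f B] by (simp add: enc_list_def)

lemma length_le_enc_list: "\<forall>x \<in> set xs. f x \<noteq> [] \<Longrightarrow> length xs \<le> length (enc_list f xs)"
proof (induction xs)
  case (Cons x xs)
  then have "1 \<le> length (f x)" by (simp add: Suc_le_eq)
  with Cons show ?case by (simp add: enc_list_def)
qed (simp add: enc_list_def)

lemma length_member_enc_list: "x \<in> set xs \<Longrightarrow> length (f x) \<le> length (enc_list f xs)"
  by (induction xs) (auto simp: enc_list_def)

lemma enc_nonempty [simp]: "enc_list f xs \<noteq> []" "enc_nat k \<noteq> []"
  by (simp_all add: enc_list_def enc_nat_def)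

lemma weights_from_bound:
  "\<forall>x \<in> set (p # b # bs). x \<le> T \<Longrightarrow>
    length (weights_from T p b bs) = Suc (length bs) \<and> (\<forall>v \<in> set (weights_from T p b bs). v \<le> 2 * T)"
proof (induction T p b bs rule: weights_from.induct)
  case (2 T p b b' bs)
  have "b \<le> T" using "2.prems" by simp
  then have "b - p \<le> T" by simp
  with 2 show ?case by simp
qed auto

lemma chain_weights_bound:
  assumes "valid_chain T zs"
  shows "length (chain_weights T zs) \<le> length zs" "\<forall>v \<in> set (chain_weights T zs). v \<le> 2 * T"
proof -
  obtain p b bs where zs: "zs = p # b # bs" and v: "\<forall>x \<in> set (p # b # bs). x \<le> T"
    using assms by (rule valid_chainE)
  from weights_from_bound[OF v] show "length (chain_weights T zs) \<le> length zs" "\<forall>v \<in> set (chain_weights T zs). v \<le> 2 * T"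
    by (simp_all add: zs)
qed

text \<open>Doubling \<open>T\<close> costs one more bit, and the symbols 3, 2, 3 account for the
  other three.\<close>

lemma length_enc_weight_le:
  assumes "v \<le> 2 * T"
  shows "length (enc_weight v) \<le> length (bits T) + 4"
proof -
  have "length (bits v) \<le> length (bits (T + T))" using assms by (intro length_bits_mono) simp
  also have "\<dots> \<le> Suc (length (bits T))" using length_bits_add[of T T] by simp
  finally show ?thesis by (simp add: enc_weight_eq)
qed

lemma valid_birthdays:
  assumes I: "I \<in> age_instances" and zs: "zs \<in> set (birthdays I)"
  shows "valid_chain (start_time I) zs"
proof -
  obtain i where "i \<in> {1..<receivers I + 1}" "zs = map (birthday I i) [0..<messages I i + 1]"
    using zs unfolding birthdays_def set_map set_upt by blast
  then have i: "i \<in> {1..receivers I}" "zs = map (birthday I i) [0..<messages I i + 1]" by auto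
  have m: "1 \<le> messages I i" "strict_mono_on {0..messages I i} (birthday I i)"
    "birthday I i (messages I i) \<le> start_time I"
    using I i by (auto simp: age_instances_def)
  have "sorted_wrt (<) zs"
    unfolding i(2) sorted_wrt_map
    by (rule sorted_wrt_mono_rel[OF _ sorted_wrt_upt]) (use strict_mono_onD[OF m(2)] in auto)
  moreover have "birthday I i j \<le> start_time I" if "j \<le> messages I i" for j
    using strict_mono_on_leD[OF m(2), of j "messages I i"] that m(3) by simp
  ultimately show ?thesis using m(1) by (auto simp: valid_chain_def i(2) less_Suc_eq_le)
qed

lemma enc_symbols:
  "set (enc_nat k) \<subseteq> {1, 2, 3}" "set (enc_weight k) \<subseteq> {1, 2, 3}"
  "\<forall>x \<in> set xs. set (f x) \<subseteq> {1, 2, 3, 4} \<Longrightarrow> set (enc_list f xs) \<subseteq> {1, 2, 3, 4}"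
  using bits_symbols[of k] by (auto simp: enc_nat_def enc_weight_eq enc_list_def)

lemma enc_list_symbols:
  assumes "\<And>k. set (f k) \<subseteq> {1, 2, 3}"
  shows "set (enc_list (enc_list f) nss) \<subseteq> {1, 2, 3, 4}"
proof -
  have "set (f k) \<subseteq> {1, 2, 3, 4}" for k using assms[of k] by auto
  then show ?thesis by (intro enc_symbols(3) ballI)
qed

lemma tm_computes_within_mono:
  assumes "tm_computes_within M x y t" "t \<le> t'"
  shows "tm_computes_within M x y t'"
proof -
  obtain ts where ts: "(tm_step M ^^ t) (tm_init M x) = (num_states M, ts)"
    "takeWhile (\<lambda>a. a \<noteq> 0) (snd (ts ! 0)) = y"
    using assms(1) by (auto simp: tm_computes_within_def split: prod.splits)
  have "(tm_step M ^^ t') (tm_init M x) = (num_states M, ts)"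
    using funpow_add[of "t' - t" t "tm_step M"] assms(2) by (simp add: ts tm_step_halted)
  then show ?thesis using ts(2) by (simp add: tm_computes_within_def)
qed

text \<open>Coefficients are natural numbers. The running time of the given machine refers to the
  length of the constructed instance, which is known only up to an upper bound.\<close>

lemma poly_nat_mono: "m \<le> n \<Longrightarrow> poly p m \<le> poly (p :: nat poly) n"
  by (induction p) (auto intro: mult_mono add_mono)

context machine_combinators
begin

lemma concat_enc_token: "concat (map enc_token (tokens nss)) = enc_list (enc_list enc_nat) nss"
  unfolding concat_map_tokens by (simp add: enc_list_def[abs_def])

lemma concat_shift_token:
  "concat (map (shift_token T) (tokens nss)) =
    enc_list (enc_list enc_nat) (map (map (\<lambda>k. k + T)) nss)"
  unfolding concat_map_tokens by (simp add: enc_list_def[abs_def] comp_def)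

text \<open>Receivers, messages per receiver and bits of the start time are each at most
  \<open>X\<close>. So the Min-WCS input has at most \<open>X\<close> chains of at most
  \<open>X\<close> weights with at most \<open>X + 4\<close> symbols each. The schedule has at most
  \<open>X * (X + 1) + 1\<close> tokens, end markers included. \<open>X * X + X\<close> bounds the
  bits both of a completion time and of the start time; a shifted token needs two symbols more, for
  a carry and the separator.\<close>

lemma reduction_correct:
  fixes p :: "nat poly"
  assumes A: "wf_tm A" "num_tapes A = K - 4" "num_symbols A = s"
    and I: "I \<in> age_instances" and S': "S' \<in> chain_schedules (receivers I) (messages I) 0"
    and comp: "tm_computes_within A (enc_wcs (wcs_of I)) (enc_schedule (receivers I) (messages I) S')
      (poly p (length (enc_wcs (wcs_of I))))"
    and X: "X = length (enc_age I)"
  shows "tm_computes_within (reduction A) (enc_age I)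
    (enc_schedule (receivers I) (messages I) (\<lambda>i j. S' i j + start_time I))
    (X * (X * (10 * X + 21) + 12 * X + 31) + 4 * X + 2 * (X * (X * (X + 4) + 1) + 1) + 20
      + (poly p (X * (X * (X + 4) + 1) + 1)
        + ((X * (X + 1) + 1) * (6 * (X * X + X) + 14)
          + 2 * ((X * (X + 1) + 1) * (X * X + X + 2)) + 6)))"
proof -
  let ?T = "start_time I" and ?css = "birthdays I"
  let ?x' = "enc_list (enc_list enc_weight) (map (chain_weights ?T) ?css)"
  let ?nss = "map (\<lambda>i. map (S' i) [1..<messages I i + 1]) [1..<receivers I + 1]"
  let ?y' = "concat (map (shift_token ?T) (tokens ?nss))"
  let ?N = "X * X + X"
  have N: "length (bits ?T) \<le> X" by (simp add: X enc_age_eq enc_nat_def)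
  have lcss: "length ?css \<le> X"
    using length_le_enc_list[of ?css "enc_list enc_nat"] by (simp add: X enc_age_eq)
  have lzs: "length zs \<le> X" if "zs \<in> set ?css" for zs
  proof -
    have "length zs \<le> length (enc_list enc_nat zs)" by (rule length_le_enc_list) simp
    also have "\<dots> \<le> length (enc_list (enc_list enc_nat) ?css)"
      by (rule length_member_enc_list) fact
    finally show ?thesis by (simp add: X enc_age_eq)
  qed
  have valid: "\<forall>zs \<in> set ?css. valid_chain ?T zs \<and> length zs \<le> X"
    using valid_birthdays[OF I] lzs by blast
  have n: "receivers I \<le> X" using lcss by (simp add: birthdays_def)
  have m: "messages I i \<le> X" if "i \<in> {1..receivers I}" for i
  proof -
    have "map (birthday I i) [0..<messages I i + 1] \<in> set ?css"
      using that by (auto simp: birthdays_def)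
    from lzs[OF this] show ?thesis by simp
  qed
  have x'_len: "length ?x' \<le> X * (X * (X + 4) + 1) + 1"
  proof -
    have "length (enc_list enc_weight (chain_weights ?T zs)) \<le> X * (X + 4) + 1" if "zs \<in> set ?css" for zs
    proof -
      have v: "valid_chain ?T zs" "length zs \<le> X" using valid that by auto
      have "\<forall>v \<in> set (chain_weights ?T zs). length (enc_weight v) \<le> X + 4"
        using chain_weights_bound(2)[OF v(1)] length_enc_weight_le N by (meson add_le_mono1 le_trans)
      from length_enc_list_le[OF this]
      have "length (enc_list enc_weight (chain_weights ?T zs)) \<le> length (chain_weights ?T zs) * (X + 4) + 1" .
      also have "\<dots> \<le> X * (X + 4) + 1"
        using chain_weights_bound(1)[OF v(1)] v(2) by (intro add_le_mono1 mult_le_mono1) simp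
      finally show ?thesis .
    qed
    then have "\<forall>vs \<in> set (map (chain_weights ?T) ?css). length (enc_list enc_weight vs) \<le> X * (X + 4) + 1" by simp
    from length_enc_list_le[OF this]
    have "length ?x' \<le> length ?css * (X * (X + 4) + 1) + 1" by simp
    also have "\<dots> \<le> X * (X * (X + 4) + 1) + 1"
      using lcss by (intro add_le_mono1 mult_le_mono1)
    finally show ?thesis .
  qed
  \<comment> \<open>A feasible schedule for Min-WCS uses the times up to the total number of
    messages only, whatever machine has produced it.\<close>
  have S'_le: "k \<le> X * X" if k: "Some k \<in> set (tokens ?nss)" for k
  proof -
    obtain ns where ns: "ns \<in> set ?nss" "k \<in> set ns" using k unfolding set_tokens by blast
    from ns(1) obtain i where i: "i \<in> {1..<receivers I + 1}" "ns = map (S' i) [1..<messages I i + 1]"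
      unfolding set_map set_upt by blast
    from ns(2) obtain j where "j \<in> {1..<messages I i + 1}" "k = S' i j"
      unfolding i(2) set_map set_upt by blast
    with i(1) have ij: "i \<in> {1..receivers I}" "j \<in> {1..messages I i}" "k = S' i j" by auto
    have "bij_betw (\<lambda>(i, j). S' i j) (SIGMA i:{1..receivers I}. {1..messages I i})
        {0 + 1..0 + (\<Sum>i = 1..receivers I. messages I i)}"
      using S' by (simp add: chain_schedules_def)
    from bij_betwE[OF this] ij have "k \<le> (\<Sum>i = 1..receivers I. messages I i)" by force
    also have "\<dots> \<le> (\<Sum>i = 1..receivers I. X)" by (rule sum_mono) (use m in auto)
    also have "\<dots> \<le> X * X" using n by simp
    finally show ?thesis .
  qed
  have bits_tok: "length (bits k) \<le> ?N" if "Some k \<in> set (tokens ?nss)" for k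
    using S'_le[OF that] length_bits_le[of k] by linarith
  have bits_T: "length (bits ?T) \<le> ?N" using N by simp
  have "\<forall>ns \<in> set ?nss. length ns \<le> X" using m by auto
  from length_tokens[OF this] have "length (tokens ?nss) \<le> receivers I * (X + 1) + 1" by simp
  also have "\<dots> \<le> X * (X + 1) + 1" using n by (intro add_le_mono1 mult_le_mono1)
  finally have toks_len: "length (tokens ?nss) \<le> X * (X + 1) + 1" .
  have "length (shift_token ?T tok) \<le> ?N + 2" if tok: "tok \<in> set (tokens ?nss)" for tok
  proof (cases tok)
    case (Some k)
    have "length (bits (k + ?T)) \<le> Suc (max (length (bits k)) (length (bits ?T)))"
      by (rule length_bits_add)
    also have "\<dots> \<le> Suc ?N" using bits_tok[of k] bits_T tok Some by simp
    finally show ?thesis by (simp add: Some enc_nat_def)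
  qed simp
  then have "length ?y' \<le> length (tokens ?nss) * (?N + 2)"
    by (intro length_concat_map_le) blast
  also have "\<dots> \<le> (X * (X + 1) + 1) * (?N + 2)" using toks_len by (rule mult_le_mono1)
  finally have y'_len: "length ?y' \<le> (X * (X + 1) + 1) * (?N + 2)" .
  have y': "?y' = enc_list (enc_list enc_nat) (map (map (\<lambda>k. k + ?T)) ?nss)"
    by (rule concat_shift_token)
  have y'_sym: "0 \<notin> set ?y'"
    unfolding y' using enc_list_symbols[of enc_nat, OF enc_symbols(1)] by fastforce
  have x_sym: "set (enc_age I) \<subseteq> {..<5}"
    unfolding enc_age_eq using enc_list_symbols[of enc_nat, OF enc_symbols(1)] enc_symbols(1)
    by fastforce
  have x'_sym: "set ?x' \<subseteq> {..<5}"
    using enc_list_symbols[of enc_weight, OF enc_symbols(2)] by fastforce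
  have comp': "tm_computes_within A ?x' (concat (map enc_token (tokens ?nss))) (poly p (length ?x'))"
    using comp unfolding concat_enc_token enc_wcs_of[OF I] enc_schedule_def .
  have bits_tok': "\<forall>k. Some k \<in> set (tokens ?nss) \<longrightarrow> length (bits k) \<le> ?N" using bits_tok by blast
  note run = tm_computes_within_reduction[OF A valid enc_age_eq x_sym refl x'_sym comp'
      bits_T bits_tok' refl y'_sym]
  have t1: "length ?css * (X * (10 * length (bits ?T) + 21) + 12 * length (bits ?T) + 31)
      \<le> X * (X * (10 * X + 21) + 12 * X + 31)"
    using lcss N by (intro mult_le_mono add_le_mono) auto
  have t2: "poly p (length ?x') \<le> poly p (X * (X * (X + 4) + 1) + 1)"
    using x'_len by (rule poly_nat_mono)
  have t3: "length (tokens ?nss) * (6 * ?N + 14) \<le> (X * (X + 1) + 1) * (6 * ?N + 14)"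
    using toks_len by (rule mult_le_mono1)
  have out: "?y' = enc_schedule (receivers I) (messages I) (\<lambda>i j. S' i j + ?T)"
    unfolding y' enc_schedule_def by (simp add: comp_def)
  show ?thesis
    unfolding out[symmetric]
    by (rule tm_computes_within_mono[OF run], intro add_le_mono t1 t2 t3 mult_le_mono order_refl N x'_len y'_len)
qed

end

theorem theorem1:
  fixes r :: real
  assumes "1 \<le> r"
    and "\<exists>A. poly_time_approx_algorithm r min_wcs A"
  shows "\<exists>B. poly_time_approx_algorithm r min_age B"
proof -
  obtain A and p :: "nat poly" where wf: "wf_tm A"
    and A: "\<And>I. I \<in> instances min_wcs \<Longrightarrow> \<exists>S \<in> feasible min_wcs I.
      tm_computes_within A (encode_instance min_wcs I) (encode_solution min_wcs I S)
        (poly p (length (encode_instance min_wcs I))) \<and>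
      objective min_wcs I S \<le> r * optimum min_wcs I"
    using assms(2) unfolding poly_time_approx_algorithm_def by blast
  \<comment> \<open>The four additional tapes hold the input and output, the start time, the
    previous birthday and the borrow or carry.\<close>
  interpret machine_combinators "num_tapes A + 4" "num_symbols A"
    by unfold_locales (use wf in \<open>auto simp: wf_tm_def\<close>)
  have tapes: "num_tapes A = num_tapes A + 4 - 4" by simp
  \<comment> \<open>\<open>X\<close> is the polynomial variable, so \<open>P\<close> can copy the
    bound of \<open>reduction_correct\<close> literally. \<open>q\<close> bounds the length of the
    Min-WCS input, and the composition of \<open>p\<close> with it bounds the running time of the
    given machine.\<close>
  define X :: "nat poly" where "X = [:0, 1:]"
  define q where "q = X * (X * (X + 4) + 1) + 1"
  define P where "P = X * (X * (10 * X + 21) + 12 * X + 31) + 4 * X + 2 * q + 20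
      + (pcompose p q + ((X * (X + 1) + 1) * (6 * (X * X + X) + 14)
        + 2 * ((X * (X + 1) + 1) * (X * X + X + 2)) + 6))"
  have poly_X: "poly X x = x" for x by (simp add: X_def)
  have poly_q: "poly q x = x * (x * (x + 4) + 1) + 1" for x
    by (simp only: q_def poly_add poly_mult poly_numeral poly_1 poly_X)
  note poly_P = poly_add poly_mult poly_numeral poly_1 poly_pcompose poly_X poly_q
  have "poly_time_approx_algorithm r min_age (reduction A)"
    unfolding poly_time_approx_algorithm_def
  proof (intro conjI exI[of _ P] ballI)
    show "wf_tm (reduction A)" using good_reduction[OF wf tapes refl] by (simp add: good_def)
    fix I assume "I \<in> instances min_age"
    then have I: "I \<in> age_instances" by (simp add: min_age_def)
    have "wcs_of I \<in> instances min_wcs" using wcs_of_instance[OF I] by (simp add: min_wcs_def)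
    then obtain S' where S': "S' \<in> feasible min_wcs (wcs_of I)"
      and comp: "tm_computes_within A (encode_instance min_wcs (wcs_of I))
        (encode_solution min_wcs (wcs_of I) S')
        (poly p (length (encode_instance min_wcs (wcs_of I))))"
      and approx: "objective min_wcs (wcs_of I) S' \<le> r * optimum min_wcs (wcs_of I)"
      using A by blast
    let ?S = "\<lambda>i j. S' i j + start_time I"
    have S'_feas: "S' \<in> chain_schedules (receivers I) (messages I) 0"
      using S' by (simp add: min_wcs_def wcs_of_def)
    have comp': "tm_computes_within A (enc_wcs (wcs_of I))
        (enc_schedule (receivers I) (messages I) S') (poly p (length (enc_wcs (wcs_of I))))"
      using comp by (simp add: min_wcs_def wcs_of_def)
    have "tm_computes_within (reduction A) (enc_age I) (enc_schedule (receivers I) (messages I) ?S)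
        (poly P (length (enc_age I)))"
      using reduction_correct[OF wf tapes refl I S'_feas comp' refl]
      unfolding P_def poly_P .
    then have "tm_computes_within (reduction A) (encode_instance min_age I)
        (encode_solution min_age I ?S) (poly P (length (encode_instance min_age I)))"
      by (simp add: min_age_def)
    with approx_transfer[OF I S' assms(1) approx]
    show "\<exists>S \<in> feasible min_age I. tm_computes_within (reduction A) (encode_instance min_age I)
        (encode_solution min_age I S) (poly P (length (encode_instance min_age I))) \<and>
        objective min_age I S \<le> r * optimum min_age I"
      by blast
  qed
  then show ?thesis by blast
qed

end
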